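(* Let $\Gamma$ be a finitely generated group and let $\rho \in \mathrm{Hom}(\Gamma,\mathrm{GL}(n,\mathbb{C}))$ be a semi-simple representation. If $\Phi_1(\chi_\rho) = \chi_\rho$, then there exist $r_1,r_2 \in \mathbb{N}$ with $r_1+2r_2 = n$, $\rho' \in \mathrm{Hom}(\Gamma, \mathrm{GL}(r_1,\mathbb{R}))$ and $\rho'' \in \mathrm{Hom}(\Gamma, \mathrm{GL}(r_2,\mathbb{H}))$ such that $\rho$ is conjugated (in $\mathrm{GL}(n,\mathbb{C})$) to $\rho' \oplus \rho''$.
   Context: $n$ is a positive integer; $\mathbb{N}$ contains $0$, and $\mathrm{GL}(0,\cdot)$ is the trivial group. A representation into $\mathrm{GL}(n,\mathbb{C})$ is irreducible if its image has no stable subspaces of $\mathbb{C}^n$ other than $\{0\}$ and $\mathbb{C}^n$, and semi-simple if it is a direct sum of irreducible representations. $\mathcal{X}_{\mathrm{GL}(n,\mathbb{C})}(\Gamma)=\mathrm{Hom}(\Gamma,\mathrm{GL}(n,\mathbb{C}))//\mathrm{GL}(n,\mathbb{C})$ is the GIT quotient by conjugation, as an affine algebraic set; $\chi_\rho$ denotes the image of $\rho$, and $\chi_\rho=\chi_{\rho'}$ iff all conjugation-invariant regular functions agree at $\rho$ and $\rho'$ (equivalently, $\mathrm{tr}\,\rho(\gamma)=\mathrm{tr}\,\rho'(\gamma)$ for all $\gamma\in\Gamma$). $\Phi_1$ is the anti-holomorphic involution of $\mathcal{X}_{\mathrm{GL}(n,\mathbb{C})}(\Gamma)$ induced by $A\mapsto\overline{A}$: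 $\Phi_1(\chi_\rho)=\chi_{\overline{\rho}}$ with $\overline{\rho}(\gamma)=\overline{\rho(\gamma)}$. $\mathrm{GL}(m,\mathbb{H})=\{M\in\mathrm{GL}(2m,\mathbb{C}):MJ=J\overline{M}\}$ with $J=\begin{pmatrix}0&I_m\\-I_m&0\end{pmatrix}$. *)

theory Defs
  imports "Jordan_Normal_Form.VS_Connect" "HOL-Algebra.Generated_Groups"
begin

section \<open>Linear groups\<close>

definition GL :: "nat \<Rightarrow> 'a::field mat monoid" where
  "GL n = units_of (ring_mat TYPE('a) n ())"

definition J_mat :: "nat \<Rightarrow> complex mat" where
  "J_mat m = four_block_mat (0\<^sub>m m m) (1\<^sub>m m) (- 1\<^sub>m m) (0\<^sub>m m m)"

definition GL_H :: "nat \<Rightarrow> complex mat monoid" where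
  "GL_H m = (GL (2 * m))\<lparr>carrier :=
     {M \<in> carrier (GL (2 * m)). M * J_mat m = J_mat m * map_mat cnj M}\<rparr>"


section \<open>Representations\<close>

definition finitely_generated_group :: "('g, 'b) monoid_scheme \<Rightarrow> bool" where
  "finitely_generated_group \<Gamma> \<longleftrightarrow>
     group \<Gamma> \<and> (\<exists>S. finite S \<and> S \<subseteq> carrier \<Gamma> \<and> generate \<Gamma> S = carrier \<Gamma>)"

abbreviation Rep :: "('g, 'b) monoid_scheme \<Rightarrow> nat \<Rightarrow> ('g \<Rightarrow> complex mat) set" where
  "Rep \<Gamma> n \<equiv> hom \<Gamma> (GL n)"

definition conj_by :: "nat \<Rightarrow> complex mat \<Rightarrow> ('g \<Rightarrow> complex mat) \<Rightarrow> 'g \<Rightarrow> complex mat" where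
  "conj_by n P \<rho> = (\<lambda>\<gamma>. P * \<rho> \<gamma> * inv\<^bsub>GL n\<^esub> P)"

definition conjugated ::
  "('g, 'b) monoid_scheme \<Rightarrow> nat \<Rightarrow> ('g \<Rightarrow> complex mat) \<Rightarrow> ('g \<Rightarrow> complex mat) \<Rightarrow> bool" where
  "conjugated \<Gamma> n \<rho> \<rho>' \<longleftrightarrow>
     (\<exists>P\<in>carrier (GL n). \<forall>\<gamma>\<in>carrier \<Gamma>. \<rho>' \<gamma> = conj_by n P \<rho> \<gamma>)"

definition cnj_rep :: "('g \<Rightarrow> complex mat) \<Rightarrow> 'g \<Rightarrow> complex mat" where
  "cnj_rep \<rho> = (\<lambda>\<gamma>. map_mat cnj (\<rho> \<gamma>))"

definition irreducible_rep ::
  "('g, 'b) monoid_scheme \<Rightarrow> nat \<Rightarrow> ('g \<Rightarrow> complex mat) \<Rightarrow> bool" where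
  "irreducible_rep \<Gamma> n \<rho> \<longleftrightarrow> 0 < n \<and> \<rho> \<in> Rep \<Gamma> n \<and>
     (\<forall>W. VectorSpace.subspace class_ring W (module_vec TYPE(complex) n) \<and>
          (\<forall>\<gamma>\<in>carrier \<Gamma>. \<forall>w\<in>W. \<rho> \<gamma> *\<^sub>v w \<in> W)
        \<longrightarrow> W = {0\<^sub>v n} \<or> W = carrier_vec n)"

text \<open>
  The summands are listed together with their dimensions; being a direct sum means, as usual,
  being isomorphic to one, that is, block diagonal in some basis of the underlying space.
\<close>

definition semisimple_rep ::
  "('g, 'b) monoid_scheme \<Rightarrow> nat \<Rightarrow> ('g \<Rightarrow> complex mat) \<Rightarrow> bool" where
  "semisimple_rep \<Gamma> n \<rho> \<longleftrightarrow> \<rho> \<in> Rep \<Gamma> n \<and>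
     (\<exists>\<sigma>s :: (nat \<times> ('g \<Rightarrow> complex mat)) list.
        (\<forall>(k, \<sigma>)\<in>set \<sigma>s. irreducible_rep \<Gamma> k \<sigma>) \<and>
        sum_list (map fst \<sigma>s) = n \<and>
        conjugated \<Gamma> n \<rho> (\<lambda>\<gamma>. diag_block_mat (map (\<lambda>(k, \<sigma>). \<sigma> \<gamma>) \<sigma>s)))"


section \<open>The character variety\<close>

text \<open>
  The algebra of regular functions on the affine algebraic set of representations.  When
  \<open>\<Gamma>\<close> is generated by a finite set \<open>S\<close>, the representations form a closed subset of a finite
  power of the general linear group, whose coordinate ring is generated by the entries of
  \<open>\<rho> s\<close> and by \<open>1 / det (\<rho> s)\<close> for \<open>s\<close> in \<open>S\<close>.  Taking the entries of \<open>\<rho> \<gamma>\<close> for all \<open>\<gamma>\<close>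
  gives the same algebra without a choice of \<open>S\<close>: these entries are polynomials in the
  entries of the \<open>\<rho> s\<close> and of their inverses, and conversely \<open>1 / det (\<rho> s)\<close> is the
  determinant of \<open>\<rho> (inv s)\<close>.  Functions are restricted to the set of representations so that
  equality in the algebra is equality as functions on this set.
\<close>

inductive_set regular_functions ::
  "('g, 'b) monoid_scheme \<Rightarrow> nat \<Rightarrow> (('g \<Rightarrow> complex mat) \<Rightarrow> complex) set"
  for \<Gamma> :: "('g, 'b) monoid_scheme" and n :: nat where
  const: "(\<lambda>\<rho>\<in>Rep \<Gamma> n. c) \<in> regular_functions \<Gamma> n"
| coord: "\<lbrakk>\<gamma> \<in> carrier \<Gamma>; i < n; j < n\<rbrakk> \<Longrightarrow> (\<lambda>\<rho>\<in>Rep \<Gamma> n. \<rho> \<gamma> $$ (i, j)) \<in> regular_functions \<Gamma> n"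
| add: "\<lbrakk>f \<in> regular_functions \<Gamma> n; g \<in> regular_functions \<Gamma> n\<rbrakk>
    \<Longrightarrow> (\<lambda>\<rho>\<in>Rep \<Gamma> n. f \<rho> + g \<rho>) \<in> regular_functions \<Gamma> n"
| mult: "\<lbrakk>f \<in> regular_functions \<Gamma> n; g \<in> regular_functions \<Gamma> n\<rbrakk>
    \<Longrightarrow> (\<lambda>\<rho>\<in>Rep \<Gamma> n. f \<rho> * g \<rho>) \<in> regular_functions \<Gamma> n"

definition invariant_functions ::
  "('g, 'b) monoid_scheme \<Rightarrow> nat \<Rightarrow> (('g \<Rightarrow> complex mat) \<Rightarrow> complex) set" where
  "invariant_functions \<Gamma> n = {f \<in> regular_functions \<Gamma> n.
     \<forall>P\<in>carrier (GL n). \<forall>\<rho>\<in>Rep \<Gamma> n. f (conj_by n P \<rho>) = f \<rho>}"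

text \<open>
  The GIT quotient is the affine algebraic set whose coordinate ring is the algebra of
  invariants; its points are the unital complex algebra homomorphisms from that algebra
  to the complex numbers.  A representation is sent to the evaluation at it.
\<close>

definition character_variety ::
  "('g, 'b) monoid_scheme \<Rightarrow> nat \<Rightarrow> ((('g \<Rightarrow> complex mat) \<Rightarrow> complex) \<Rightarrow> complex) set" where
  "character_variety \<Gamma> n = {x \<in> extensional (invariant_functions \<Gamma> n).
     (\<forall>c. x (\<lambda>\<rho>\<in>Rep \<Gamma> n. c) = c) \<and>
     (\<forall>f\<in>invariant_functions \<Gamma> n. \<forall>g\<in>invariant_functions \<Gamma> n.
        x (\<lambda>\<rho>\<in>Rep \<Gamma> n. f \<rho> + g \<rho>) = x f + x g \<and>
        x (\<lambda>\<rho>\<in>Rep \<Gamma> n. f \<rho> * g \<rho>) = x f * x g)}"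

definition chi :: "('g, 'b) monoid_scheme \<Rightarrow> nat \<Rightarrow> ('g \<Rightarrow> complex mat)
    \<Rightarrow> (('g \<Rightarrow> complex mat) \<Rightarrow> complex) \<Rightarrow> complex" where
  "chi \<Gamma> n \<rho> = (\<lambda>f\<in>invariant_functions \<Gamma> n. f \<rho>)"

text \<open>
  Complex conjugation of matrices acts on the algebra of functions by the conjugate-linear
  ring automorphism \<open>cnj_fun\<close>, hence on points by \<open>Phi1\<close>.  That this is the involution
  sending \<open>chi \<Gamma> n \<rho>\<close> to the point of the conjugate representation is lemma \<open>Phi1_chi\<close>.
\<close>

definition cnj_fun :: "('g, 'b) monoid_scheme \<Rightarrow> nat
    \<Rightarrow> (('g \<Rightarrow> complex mat) \<Rightarrow> complex) \<Rightarrow> ('g \<Rightarrow> complex mat) \<Rightarrow> complex" where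
  "cnj_fun \<Gamma> n f = (\<lambda>\<rho>\<in>Rep \<Gamma> n. cnj (f (cnj_rep \<rho>)))"

definition Phi1 :: "('g, 'b) monoid_scheme \<Rightarrow> nat
    \<Rightarrow> ((('g \<Rightarrow> complex mat) \<Rightarrow> complex) \<Rightarrow> complex)
    \<Rightarrow> (('g \<Rightarrow> complex mat) \<Rightarrow> complex) \<Rightarrow> complex" where
  "Phi1 \<Gamma> n x = (\<lambda>f\<in>invariant_functions \<Gamma> n. cnj (x (cnj_fun \<Gamma> n f)))"


section \<open>Basic properties\<close>

lemma group_GL: "group (GL n :: 'a::field mat monoid)"
proof -
  interpret R: semiring "ring_mat TYPE('a) n ()" by (rule semiring_mat)
  show ?thesis unfolding GL_def by (rule R.units_group)
qed

lemma GL_simps [simp]: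
  "mult (GL n :: 'a::field mat monoid) = (*)"
  "one (GL n :: 'a::field mat monoid) = 1\<^sub>m n"
  by (auto simp: GL_def units_of_def ring_mat_def)

lemma carrier_GL: "carrier (GL n :: 'a::field mat monoid) =
    {A \<in> carrier_mat n n. \<exists>B\<in>carrier_mat n n. B * A = 1\<^sub>m n \<and> A * B = 1\<^sub>m n}"
  by (auto simp: GL_def units_of_def Units_def ring_mat_def)

lemma GL_carrier_mat: "A \<in> carrier (GL n) \<Longrightarrow> A \<in> carrier_mat n n"
  by (simp add: carrier_GL)

lemma carrier_GL_iff_invertible_mat:
  "A \<in> carrier (GL n) \<longleftrightarrow> A \<in> carrier_mat n n \<and> invertible_mat (A :: 'a::field mat)"
proof
  assume "A \<in> carrier (GL n)"
  then show "A \<in> carrier_mat n n \<and> invertible_mat A"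
    unfolding carrier_GL invertible_mat_def inverts_mat_def by (auto intro: exI)
next
  assume A: "A \<in> carrier_mat n n \<and> invertible_mat A"
  then obtain B where B: "A * B = 1\<^sub>m n" "B * A = 1\<^sub>m (dim_row B)"
    unfolding invertible_mat_def inverts_mat_def by auto
  have "dim_col (A * B) = n" "dim_col (B * A) = dim_row B"
    using B by simp_all
  then have "B \<in> carrier_mat n n" using A by auto
  with A B show "A \<in> carrier (GL n)" unfolding carrier_GL by auto
qed

lemma map_mat_cnj_mult:
  assumes "A \<in> carrier_mat n n" "B \<in> carrier_mat n n"
  shows "map_mat cnj (A * B) = map_mat cnj A * map_mat cnj B"
proof -
  interpret semiring_hom cnj by unfold_locales auto
  show ?thesis using assms by (rule mat_hom_mult)
qed

lemma cnj_hom_GL: "map_mat cnj \<in> hom (GL n) (GL n)"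
proof (rule homI)
  fix A :: "complex mat" assume A: "A \<in> carrier (GL n)"
  then obtain B where AB: "A \<in> carrier_mat n n" "B \<in> carrier_mat n n"
      "B * A = 1\<^sub>m n" "A * B = 1\<^sub>m n"
    by (auto simp: carrier_GL)
  have one: "map_mat cnj (1\<^sub>m n) = 1\<^sub>m n" by (intro eq_matI) auto
  have "map_mat cnj B * map_mat cnj A = 1\<^sub>m n" "map_mat cnj A * map_mat cnj B = 1\<^sub>m n"
    using AB one map_mat_cnj_mult[of _ n] by metis+
  with AB show "map_mat cnj A \<in> carrier (GL n)"
    unfolding carrier_GL by (auto intro!: bexI[of _ "map_mat cnj B"])
next
  fix A B :: "complex mat" assume "A \<in> carrier (GL n)" "B \<in> carrier (GL n)"
  then show "map_mat cnj (A \<otimes>\<^bsub>GL n\<^esub> B) = map_mat cnj A \<otimes>\<^bsub>GL n\<^esub> map_mat cnj B"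
    by (simp add: map_mat_cnj_mult[of _ n] GL_carrier_mat)
qed

lemma cnj_rep_in_Rep: "\<rho> \<in> Rep \<Gamma> n \<Longrightarrow> cnj_rep \<rho> \<in> Rep \<Gamma> n"
  using hom_compose[OF _ cnj_hom_GL] by (fastforce simp: cnj_rep_def o_def)

lemma cnj_rep_cnj_rep [simp]: "cnj_rep (cnj_rep \<rho>) = \<rho>"
  by (auto simp: cnj_rep_def intro!: eq_matI)

lemma conj_by_in_Rep:
  assumes "group \<Gamma>" "P \<in> carrier (GL n)" "\<rho> \<in> Rep \<Gamma> n"
  shows "conj_by n P \<rho> \<in> Rep \<Gamma> n"
proof -
  interpret G: group "GL n :: complex mat monoid" by (rule group_GL)
  interpret group \<Gamma> by fact
  have in_GL: "\<rho> \<gamma> \<in> carrier (GL n)" if "\<gamma> \<in> carrier \<Gamma>" for \<gamma>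
    using assms(3) that by (auto simp: hom_def)
  have eq: "conj_by n P \<rho> = (\<lambda>\<gamma>. P \<otimes>\<^bsub>GL n\<^esub> \<rho> \<gamma> \<otimes>\<^bsub>GL n\<^esub> inv\<^bsub>GL n\<^esub> P)"
    by (simp add: conj_by_def)
  have inv_l: "inv\<^bsub>GL n\<^esub> P \<otimes>\<^bsub>GL n\<^esub> (P \<otimes>\<^bsub>GL n\<^esub> X) = X" if "X \<in> carrier (GL n)" for X
    using that assms(2) G.inv_solve_left G.m_closed by (metis G.inv_closed G.l_inv G.l_one G.m_assoc)
  show ?thesis
    unfolding eq
  proof (rule homI, goal_cases)
    case (1 x)
    then show ?case using in_GL assms(2) by (simp del: GL_simps)
  next
    case (2 x y)
    then have "\<rho> (x \<otimes>\<^bsub>\<Gamma>\<^esub> y) = \<rho> x \<otimes>\<^bsub>GL n\<^esub> \<rho> y" using assms(3) by (auto simp: hom_def)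
    then show ?case
      using in_GL[OF 2(1)] in_GL[OF 2(2)] assms(2)
      by (simp add: G.m_assoc inv_l del: GL_simps)
  qed
qed

lemma cnj_rep_conj_by:
  assumes "group \<Gamma>" "P \<in> carrier (GL n)" "\<rho> \<in> Rep \<Gamma> n" "\<gamma> \<in> carrier \<Gamma>"
  shows "cnj_rep (conj_by n P \<rho>) \<gamma> = conj_by n (map_mat cnj P) (cnj_rep \<rho>) \<gamma>"
proof -
  interpret c: group_hom "GL n" "GL n" "map_mat cnj :: complex mat \<Rightarrow> complex mat"
    by (intro group_hom.intro group_hom_axioms.intro group_GL cnj_hom_GL)
  have \<rho>: "\<rho> \<gamma> \<in> carrier (GL n)" using assms(3,4) by (auto simp: hom_def)
  have "map_mat cnj (P \<otimes>\<^bsub>GL n\<^esub> \<rho> \<gamma> \<otimes>\<^bsub>GL n\<^esub> inv\<^bsub>GL n\<^esub> P) =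
     map_mat cnj P \<otimes>\<^bsub>GL n\<^esub> map_mat cnj (\<rho> \<gamma>) \<otimes>\<^bsub>GL n\<^esub> inv\<^bsub>GL n\<^esub> (map_mat cnj P)"
    using assms(2) \<rho> by (simp del: GL_simps)
  then show ?thesis by (simp add: cnj_rep_def conj_by_def)
qed

lemma regular_functions_cong:
  assumes "f \<in> regular_functions \<Gamma> n" "\<rho> \<in> Rep \<Gamma> n" "\<rho>' \<in> Rep \<Gamma> n"
    and "\<And>\<gamma>. \<gamma> \<in> carrier \<Gamma> \<Longrightarrow> \<rho> \<gamma> = \<rho>' \<gamma>"
  shows "f \<rho> = f \<rho>'"
  using assms by (induction rule: regular_functions.induct) auto

lemma regular_functions_extensional:
  "f \<in> regular_functions \<Gamma> n \<Longrightarrow> f \<in> extensional (Rep \<Gamma> n)"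
  by (induction rule: regular_functions.induct) (auto simp: extensional_def)

lemma cnj_fun_regular:
  assumes "f \<in> regular_functions \<Gamma> n"
  shows "cnj_fun \<Gamma> n f \<in> regular_functions \<Gamma> n"
  using assms
proof (induction rule: regular_functions.induct)
  case (const c)
  have "cnj_fun \<Gamma> n (\<lambda>\<rho>\<in>Rep \<Gamma> n. c) = (\<lambda>\<rho>\<in>Rep \<Gamma> n. cnj c)"
    by (auto simp: cnj_fun_def cnj_rep_in_Rep)
  then show ?case by (metis regular_functions.const)
next
  case (coord \<gamma> i j)
  have "cnj (cnj_rep \<rho> \<gamma> $$ (i, j)) = \<rho> \<gamma> $$ (i, j)" if "\<rho> \<in> Rep \<Gamma> n" for \<rho>
  proof -
    have "\<rho> \<gamma> \<in> carrier (GL n)" using that coord by (auto simp: hom_def)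
    then show ?thesis using coord GL_carrier_mat[of "\<rho> \<gamma>" n] by (auto simp: cnj_rep_def)
  qed
  then have "cnj_fun \<Gamma> n (\<lambda>\<rho>\<in>Rep \<Gamma> n. \<rho> \<gamma> $$ (i, j)) = (\<lambda>\<rho>\<in>Rep \<Gamma> n. \<rho> \<gamma> $$ (i, j))"
    by (auto simp: cnj_fun_def cnj_rep_in_Rep)
  with coord show ?case by (metis regular_functions.coord)
next
  case (add f g)
  have "cnj_fun \<Gamma> n (\<lambda>\<rho>\<in>Rep \<Gamma> n. f \<rho> + g \<rho>) =
      (\<lambda>\<rho>\<in>Rep \<Gamma> n. cnj_fun \<Gamma> n f \<rho> + cnj_fun \<Gamma> n g \<rho>)"
    by (auto simp: cnj_fun_def cnj_rep_in_Rep)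
  with add show ?case by (metis regular_functions.add)
next
  case (mult f g)
  have "cnj_fun \<Gamma> n (\<lambda>\<rho>\<in>Rep \<Gamma> n. f \<rho> * g \<rho>) =
      (\<lambda>\<rho>\<in>Rep \<Gamma> n. cnj_fun \<Gamma> n f \<rho> * cnj_fun \<Gamma> n g \<rho>)"
    by (auto simp: cnj_fun_def cnj_rep_in_Rep)
  with mult show ?case by (metis regular_functions.mult)
qed

lemma cnj_fun_invariant:
  assumes "group \<Gamma>" "f \<in> invariant_functions \<Gamma> n"
  shows "cnj_fun \<Gamma> n f \<in> invariant_functions \<Gamma> n"
proof -
  have f: "f \<in> regular_functions \<Gamma> n" using assms by (simp add: invariant_functions_def)
  have "cnj_fun \<Gamma> n f (conj_by n P \<rho>) = cnj_fun \<Gamma> n f \<rho>"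
    if P: "P \<in> carrier (GL n)" and \<rho>: "\<rho> \<in> Rep \<Gamma> n" for P \<rho>
  proof -
    have P': "map_mat cnj P \<in> carrier (GL n)" using P cnj_hom_GL by (auto simp: hom_def)
    have "f (cnj_rep (conj_by n P \<rho>)) = f (conj_by n (map_mat cnj P) (cnj_rep \<rho>))"
      by (rule regular_functions_cong[OF f])
        (simp_all add: cnj_rep_conj_by[OF assms(1) P \<rho>] cnj_rep_in_Rep conj_by_in_Rep assms(1) P P' \<rho>)
    also have "\<dots> = f (cnj_rep \<rho>)"
      using assms(2) P' cnj_rep_in_Rep[OF \<rho>] by (simp add: invariant_functions_def)
    finally show ?thesis
      using conj_by_in_Rep[OF assms(1) P \<rho>] \<rho> by (simp add: cnj_fun_def)
  qed
  then show ?thesis using cnj_fun_regular[OF f] by (simp add: invariant_functions_def)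
qed

lemma cnj_fun_cnj_fun:
  assumes "f \<in> invariant_functions \<Gamma> n"
  shows "cnj_fun \<Gamma> n (cnj_fun \<Gamma> n f) = f"
proof -
  have "f \<in> extensional (Rep \<Gamma> n)"
    using assms regular_functions_extensional by (auto simp: invariant_functions_def)
  then show ?thesis
    by (auto simp: cnj_fun_def cnj_rep_in_Rep fun_eq_iff extensional_def)
qed

lemma invariant_const:
  "group \<Gamma> \<Longrightarrow> (\<lambda>\<rho>\<in>Rep \<Gamma> n. c) \<in> invariant_functions \<Gamma> n"
  by (auto simp: invariant_functions_def conj_by_in_Rep intro: regular_functions.const)

lemma invariant_add:
  "\<lbrakk>group \<Gamma>; f \<in> invariant_functions \<Gamma> n; g \<in> invariant_functions \<Gamma> n\<rbrakk>
    \<Longrightarrow> (\<lambda>\<rho>\<in>Rep \<Gamma> n. f \<rho> + g \<rho>) \<in> invariant_functions \<Gamma> n"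
  by (auto simp: invariant_functions_def conj_by_in_Rep intro: regular_functions.add)

lemma invariant_mult:
  "\<lbrakk>group \<Gamma>; f \<in> invariant_functions \<Gamma> n; g \<in> invariant_functions \<Gamma> n\<rbrakk>
    \<Longrightarrow> (\<lambda>\<rho>\<in>Rep \<Gamma> n. f \<rho> * g \<rho>) \<in> invariant_functions \<Gamma> n"
  by (auto simp: invariant_functions_def conj_by_in_Rep intro: regular_functions.mult)

lemma chi_in_character_variety:
  "\<lbrakk>group \<Gamma>; \<rho> \<in> Rep \<Gamma> n\<rbrakk> \<Longrightarrow> chi \<Gamma> n \<rho> \<in> character_variety \<Gamma> n"
  by (auto simp: character_variety_def chi_def invariant_const invariant_add invariant_mult)

lemma chi_eq_iff:
  "chi \<Gamma> n \<rho> = chi \<Gamma> n \<rho>' \<longleftrightarrow> (\<forall>f\<in>invariant_functions \<Gamma> n. f \<rho> = f \<rho>')"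
  by (auto simp: chi_def fun_eq_iff restrict_def)

lemma Phi1_in_character_variety:
  assumes "group \<Gamma>" "x \<in> character_variety \<Gamma> n"
  shows "Phi1 \<Gamma> n x \<in> character_variety \<Gamma> n"
proof -
  have c: "cnj_fun \<Gamma> n (\<lambda>\<rho>\<in>Rep \<Gamma> n. c) = (\<lambda>\<rho>\<in>Rep \<Gamma> n. cnj c)" for c
    by (auto simp: cnj_fun_def cnj_rep_in_Rep)
  have a: "cnj_fun \<Gamma> n (\<lambda>\<rho>\<in>Rep \<Gamma> n. f \<rho> + g \<rho>) =
      (\<lambda>\<rho>\<in>Rep \<Gamma> n. cnj_fun \<Gamma> n f \<rho> + cnj_fun \<Gamma> n g \<rho>)" for f g
    by (auto simp: cnj_fun_def cnj_rep_in_Rep)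
  have m: "cnj_fun \<Gamma> n (\<lambda>\<rho>\<in>Rep \<Gamma> n. f \<rho> * g \<rho>) =
      (\<lambda>\<rho>\<in>Rep \<Gamma> n. cnj_fun \<Gamma> n f \<rho> * cnj_fun \<Gamma> n g \<rho>)" for f g
    by (auto simp: cnj_fun_def cnj_rep_in_Rep)
  show ?thesis
    using assms
    by (simp add: character_variety_def Phi1_def invariant_const invariant_add invariant_mult
        c a m cnj_fun_invariant)
qed

lemma Phi1_Phi1:
  assumes "group \<Gamma>" "x \<in> character_variety \<Gamma> n"
  shows "Phi1 \<Gamma> n (Phi1 \<Gamma> n x) = x"
  using assms
  by (auto simp: Phi1_def character_variety_def cnj_fun_invariant cnj_fun_cnj_fun fun_eq_iff
      extensional_def)

lemma Phi1_chi:
  assumes "group \<Gamma>" "\<rho> \<in> Rep \<Gamma> n"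
  shows "Phi1 \<Gamma> n (chi \<Gamma> n \<rho>) = chi \<Gamma> n (cnj_rep \<rho>)"
  using assms cnj_fun_invariant[OF assms(1)]
  by (auto simp: Phi1_def chi_def fun_eq_iff restrict_def cnj_fun_def)

end

theory Submission
  imports Defs "Jordan_Normal_Form.Spectral_Radius"
begin

text \<open>
  The trace of \<open>\<rho> \<gamma>\<close> is a conjugation-invariant regular function of \<open>\<rho>\<close>, so a point fixed by the
  involution belongs to a representation whose character is real.  The rest of the proof concerns
  a direct sum of irreducible representations with a real character.

  Characters of inequivalent irreducible representations are linearly independent.  For an infinite
  group there is no averaging, and the group algebra takes its place: some element of it acts as
  zero on finitely many given irreducible representations inequivalent to \<open>\<sigma>\<close>, but has an eigenvector
  of eigenvalue \<open>1\<close> on \<open>\<sigma>\<close> (\<open>annihilate_inequivalent_reps\<close>), and in characteristic zero some power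
  of it has a nonzero trace on \<open>\<sigma>\<close>.  Hence two direct sums with the same character share every
  irreducible summand up to equivalence (\<open>equal_characters_common_summand\<close>).

  Applied to the direct sum and its conjugate, this shows that the conjugate of each irreducible
  summand \<open>\<sigma>\<close> occurs among the summands.  If \<open>\<sigma>\<close> is equivalent to its own conjugate, then it
  commutes with an antilinear map of square \<open>1\<close> or \<open>-1\<close> (\<open>irreducible_conj_structure\<close>); otherwise
  \<open>\<sigma>\<close> together with its conjugate commutes with an antilinear map of square \<open>1\<close>, which exchanges
  the two (\<open>conj_structure_sum_cnj\<close>).  Collecting the summands by the sign gives a decomposition
  into two representations, one with a real and one with a quaternionic structure
  (\<open>real_character_real_quaternionic_sum\<close>).

  Finally, in a suitable basis an antilinear map of square \<open>1\<close> is complex conjugation, and one of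
  square \<open>-1\<close> is conjugation followed by \<open>J\<close>.  Both are instances of Hilbert's Theorem 90
  (\<open>hilbert90\<close>), applied once to the whole real part and once to the whole quaternionic part.
\<close>

section \<open>Traces of matrices\<close>

definition mat_trace :: "'a::comm_ring_1 mat \<Rightarrow> 'a" where
  "mat_trace A = (\<Sum>i<dim_row A. A $$ (i, i))"

lemma mat_trace_comm:
  assumes "A \<in> carrier_mat n m" "B \<in> carrier_mat m n"
  shows "mat_trace (A * B) = mat_trace (B * A)"
proof -
  have "mat_trace (A * B) = (\<Sum>i<n. \<Sum>j<m. A $$ (i, j) * B $$ (j, i))"
    using assms by (simp add: mat_trace_def scalar_prod_def atLeast0LessThan)
  also have "\<dots> = (\<Sum>j<m. \<Sum>i<n. B $$ (j, i) * A $$ (i, j))"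
    by (subst sum.swap) (simp add: mult.commute)
  also have "\<dots> = mat_trace (B * A)"
    using assms by (simp add: mat_trace_def scalar_prod_def atLeast0LessThan)
  finally show ?thesis .
qed

lemma mat_trace_conjugate:
  assumes "A \<in> carrier_mat n n" "P \<in> carrier_mat n n" "Q \<in> carrier_mat n n" "Q * P = 1\<^sub>m n"
  shows "mat_trace (P * A * Q) = mat_trace A"
proof -
  have "mat_trace (P * A * Q) = mat_trace (Q * (P * A))"
    using assms by (intro mat_trace_comm[of _ n n]) auto
  also have "Q * (P * A) = A" using assms by (simp flip: assoc_mult_mat[of Q n n P n A n])
  finally show ?thesis .
qed

lemma mat_trace_add:
  "\<lbrakk>A \<in> carrier_mat n n; B \<in> carrier_mat n n\<rbrakk> \<Longrightarrow> mat_trace (A + B) = mat_trace A + mat_trace B"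
  by (auto simp: mat_trace_def sum.distrib)

lemma mat_trace_smult:
  "A \<in> carrier_mat n n \<Longrightarrow> mat_trace (c \<cdot>\<^sub>m A) = c * mat_trace A"
  by (auto simp: mat_trace_def sum_distrib_left)

lemma mat_trace_zero [simp]: "mat_trace (0\<^sub>m n n) = 0"
  by (simp add: mat_trace_def)

lemma mat_trace_one [simp]: "mat_trace (1\<^sub>m n) = of_nat n"
  by (simp add: mat_trace_def)

lemma mat_trace_cnj: "A \<in> carrier_mat n n \<Longrightarrow> mat_trace (map_mat cnj A) = cnj (mat_trace A)"
  by (auto simp: mat_trace_def)

lemma upper_triangular_pow:
  fixes A :: "'a::comm_ring_1 mat"
  assumes A: "A \<in> carrier_mat n n" and tri: "upper_triangular A"
  shows "upper_triangular (A ^\<^sub>m m) \<and> (\<forall>i<n. (A ^\<^sub>m m) $$ (i, i) = (A $$ (i, i)) ^ m)"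
proof (induction m)
  case 0
  then show ?case using A by auto
next
  case (Suc m)
  let ?B = "A ^\<^sub>m m"
  have B: "?B \<in> carrier_mat n n" using A by auto
  have entry: "(?B * A) $$ (i, j) = (\<Sum>l<n. ?B $$ (i, l) * A $$ (l, j))" if "i < n" "j < n" for i j
    using that A B by (simp add: scalar_prod_def atLeast0LessThan)
  have low: "?B $$ (i, l) * A $$ (l, j) = 0" if "i < n" "l < n" "l < i \<or> j < l" for i j l
    using that Suc.IH tri A B by (auto simp: upper_triangular_def)
  have "(?B * A) $$ (i, j) = 0" if "j < i" "i < n" for i j
    using that by (subst entry) (auto intro!: sum.neutral low)
  moreover have "(?B * A) $$ (i, i) = (A $$ (i, i)) ^ Suc m" if i: "i < n" for i
  proof -
    have "(?B * A) $$ (i, i) = (\<Sum>l<n. if l = i then ?B $$ (i, i) * A $$ (i, i) else 0)"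
      unfolding entry[OF i i] by (rule sum.cong) (use i in \<open>auto intro!: low\<close>)
    then show ?thesis using i Suc.IH by simp
  qed
  ultimately show ?case using A B by (auto intro!: upper_triangularI)
qed

lemma mat_trace_pow_eq_power_sum:
  fixes A :: "complex mat"
  assumes A: "A \<in> carrier_mat n n"
  obtains es where "char_poly A = (\<Prod>e\<leftarrow>es. [:- e, 1:])"
    and "\<And>m. mat_trace (A ^\<^sub>m m) = (\<Sum>e\<leftarrow>es. e ^ m)"
proof -
  obtain as where as: "char_poly A = (\<Prod>a\<leftarrow>as. [:- a, 1:])"
    using char_poly_factorized[OF A] by auto
  obtain B where B: "B \<in> carrier_mat n n" "upper_triangular B" "similar_mat A B"
    using schur_decomposition_exists[OF A as] by auto
  obtain P Q where wit: "similar_mat_wit A B P Q" using B(3) by (auto simp: similar_mat_def)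
  note PQ = similar_mat_witD2[OF A wit]
  have trace: "mat_trace (A ^\<^sub>m m) = (\<Sum>e\<leftarrow>diag_mat B. e ^ m)" for m
  proof -
    have "mat_trace (A ^\<^sub>m m) = mat_trace (P * B ^\<^sub>m m * Q)"
      using similar_mat_wit_pow_id[OF wit] by simp
    also have "\<dots> = mat_trace (B ^\<^sub>m m)"
      using PQ B(1) by (intro mat_trace_conjugate[of _ n]) auto
    also have "\<dots> = (\<Sum>i<n. (B $$ (i, i)) ^ m)"
      using B(1) upper_triangular_pow[OF B(1,2), of m] by (simp add: mat_trace_def)
    also have "\<dots> = (\<Sum>e\<leftarrow>diag_mat B. e ^ m)"
      using B(1) by (simp add: diag_mat_def o_def interv_sum_list_conv_sum_set_nat atLeast0LessThan)
    finally show ?thesis .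
  qed
  have "char_poly A = (\<Prod>e\<leftarrow>diag_mat B. [:- e, 1:])"
    using char_poly_similar[OF B(3)] char_poly_upper_triangular[OF B(1,2)] by simp
  with trace show ?thesis by (rule that[rotated])
qed

text \<open>
  The power sums of the eigenvalues determine the sum over the eigenvalues of any polynomial, and
  for a polynomial vanishing at \<open>0\<close> and at all eigenvalues but \<open>1\<close> this sum is a nonzero multiple
  of the multiplicity of the eigenvalue \<open>1\<close>.
\<close>

lemma exists_power_with_nonzero_trace:
  fixes A :: "complex mat"
  assumes A: "A \<in> carrier_mat n n" and v: "v \<in> carrier_vec n" "v \<noteq> 0\<^sub>v n" "A *\<^sub>v v = v"
  shows "\<exists>m. mat_trace (A ^\<^sub>m Suc m) \<noteq> 0"
proof (rule ccontr)
  assume "\<nexists>m. mat_trace (A ^\<^sub>m Suc m) \<noteq> 0"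
  then have zero: "mat_trace (A ^\<^sub>m m) = 0" if "m \<noteq> 0" for m
    using that by (metis not0_implies_Suc)
  obtain es where es: "char_poly A = (\<Prod>e\<leftarrow>es. [:- e, 1:])"
    and sums: "\<And>m. mat_trace (A ^\<^sub>m m) = (\<Sum>e\<leftarrow>es. e ^ m)"
    using mat_trace_pow_eq_power_sum[OF A] by blast
  have "eigenvalue A 1" using A v unfolding eigenvalue_def eigenvector_def by (intro exI[of _ v]) auto
  then have "poly (char_poly A) 1 = 0" using eigenvalue_root_char_poly[OF A] by simp
  then have one: "1 \<in> set es" unfolding es by (auto simp: poly_prod_list prod_list_zero_iff)
  define p :: "complex poly" where "p = [:0, 1:] * (\<Prod>e\<in>set es - {1}. [:- e, 1:])"
  have p1: "poly p 1 \<noteq> 0" by (auto simp: p_def poly_prod)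
  have p0: "poly p e = 0" if "e \<in> set es" "e \<noteq> 1" for e
    using that by (auto simp: p_def poly_prod)
  have coeff0: "coeff p 0 = 0" by (simp add: p_def coeff_mult)
  have swap: "(\<Sum>e\<leftarrow>xs. poly p e) = (\<Sum>i\<le>degree p. coeff p i * (\<Sum>e\<leftarrow>xs. e ^ i))" for xs
    by (induction xs) (simp_all add: poly_altdef sum.distrib algebra_simps)
  have count: "(\<Sum>e\<leftarrow>xs. poly p e) = of_nat (count_list xs 1) * poly p 1" if "set xs \<subseteq> set es" for xs
    using that by (induction xs) (auto simp: p0 algebra_simps)
  have "(\<Sum>e\<leftarrow>es. poly p e) = 0"
    unfolding swap using coeff0 zero sums by (intro sum.neutral) (metis mult_eq_0_iff)
  moreover have "count_list es 1 \<noteq> 0" using one by (simp add: count_list_0_iff)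
  ultimately show False using count[of es] p1 by simp
qed

section \<open>Linear maps and their graphs\<close>

lemma smult_smult_mat: "a \<cdot>\<^sub>m (b \<cdot>\<^sub>m A) = (a * b) \<cdot>\<^sub>m (A :: 'a::semigroup_mult mat)"
  by (intro eq_matI) (auto simp: mult.assoc)

lemma one_smult_mat: "1 \<cdot>\<^sub>m A = (A :: 'a::monoid_mult mat)"
  by (intro eq_matI) auto

lemma smult_mat_mult_vec:
  fixes A :: "'a::comm_ring_1 mat"
  assumes "A \<in> carrier_mat k l" "v \<in> carrier_vec l"
  shows "(c \<cdot>\<^sub>m A) *\<^sub>v v = c \<cdot>\<^sub>v (A *\<^sub>v v)"
  using assms by (intro eq_vecI) auto

text \<open>
  Linear maps are given below by their graphs; a graph on all of the coordinate space is that
  of a matrix, whose columns are the images of the unit vectors.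
\<close>

lemma linear_relation_matrix:
  fixes R :: "('a::field vec \<times> 'a vec) set"
  assumes sub: "R \<subseteq> carrier_vec l \<times> carrier_vec k"
    and add: "\<And>x y x' y'. \<lbrakk>(x, y) \<in> R; (x', y') \<in> R\<rbrakk> \<Longrightarrow> (x + x', y + y') \<in> R"
    and smult: "\<And>c x y. (x, y) \<in> R \<Longrightarrow> (c \<cdot>\<^sub>v x, c \<cdot>\<^sub>v y) \<in> R"
    and total: "\<And>x. x \<in> carrier_vec l \<Longrightarrow> \<exists>y. (x, y) \<in> R"
    and single: "\<And>y. (0\<^sub>v l, y) \<in> R \<Longrightarrow> y = 0\<^sub>v k"
  obtains P where "P \<in> carrier_mat k l" "\<And>x y. (x, y) \<in> R \<Longrightarrow> y = P *\<^sub>v x"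
proof -
  have "\<forall>i. \<exists>y. (unit_vec l i, y) \<in> R" using total by simp
  then obtain y where y: "\<And>i. (unit_vec l i, y i) \<in> R" by metis
  have y_carrier: "y i \<in> carrier_vec k" for i using y sub by blast
  define P where "P = mat k l (\<lambda>(r, i). y i $ r)"
  have "w = P *\<^sub>v x" if xw: "(x, w) \<in> R" for x w
  proof -
    have x: "x \<in> carrier_vec l" and w: "w \<in> carrier_vec k" using xw sub by auto
    have partial: "(vec l (\<lambda>i. if i < m then x $ i else 0), vec k (\<lambda>r. \<Sum>i<m. x $ i * y i $ r)) \<in> R"
      if "m \<le> l" for m
      using that
    proof (induction m)
      case 0
      have "(0 \<cdot>\<^sub>v unit_vec l 0, 0 \<cdot>\<^sub>v y 0) \<in> R" using smult y by blast
      moreover have "0 \<cdot>\<^sub>v unit_vec l 0 = vec l (\<lambda>i. if i < 0 then x $ i else 0)"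
        by (auto simp: unit_vec_def)
      moreover have "0 \<cdot>\<^sub>v y 0 = vec k (\<lambda>r. \<Sum>i<0. x $ i * y i $ r)"
        using y_carrier[of 0] by auto
      ultimately show ?case by simp
    next
      case (Suc m)
      have "(vec l (\<lambda>i. if i < m then x $ i else 0) + x $ m \<cdot>\<^sub>v unit_vec l m,
             vec k (\<lambda>r. \<Sum>i<m. x $ i * y i $ r) + x $ m \<cdot>\<^sub>v y m) \<in> R"
        using Suc y smult add by simp
      moreover have "vec l (\<lambda>i. if i < m then x $ i else 0) + x $ m \<cdot>\<^sub>v unit_vec l m =
          vec l (\<lambda>i. if i < Suc m then x $ i else 0)"
        using Suc.prems by (intro eq_vecI) (auto simp: unit_vec_def less_Suc_eq)
      moreover have "vec k (\<lambda>r. \<Sum>i<m. x $ i * y i $ r) + x $ m \<cdot>\<^sub>v y m =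
          vec k (\<lambda>r. \<Sum>i<Suc m. x $ i * y i $ r)"
        using y_carrier[of m] by (intro eq_vecI) auto
      ultimately show ?case by simp
    qed
    have "vec l (\<lambda>i. if i < l then x $ i else 0) = x" using x by (intro eq_vecI) auto
    moreover have "vec k (\<lambda>r. \<Sum>i<l. x $ i * y i $ r) = P *\<^sub>v x"
      using x by (intro eq_vecI) (auto simp: P_def scalar_prod_def atLeast0LessThan mult.commute intro!: sum.cong)
    ultimately have "(x, P *\<^sub>v x) \<in> R" using partial[of l] by simp
    then have "(x + (-1) \<cdot>\<^sub>v x, w + (-1) \<cdot>\<^sub>v (P *\<^sub>v x)) \<in> R" using xw smult add by blast
    moreover have "x + (-1) \<cdot>\<^sub>v x = 0\<^sub>v l" using x by (intro eq_vecI) auto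
    ultimately have d: "w + (-1) \<cdot>\<^sub>v (P *\<^sub>v x) = 0\<^sub>v k" using single by simp
    show ?thesis
    proof (rule eq_vecI)
      fix i assume "i < dim_vec (P *\<^sub>v x)"
      then have i: "i < k" by (simp add: P_def)
      have "(w + (-1) \<cdot>\<^sub>v (P *\<^sub>v x)) $ i = 0" using d i by simp
      then show "w $ i = (P *\<^sub>v x) $ i" using i w by (simp add: P_def)
    qed (use w in \<open>simp add: P_def\<close>)
  qed
  moreover have "P \<in> carrier_mat k l" by (simp add: P_def)
  ultimately show ?thesis using that by blast
qed

lemma mult_mat_zero_vec: "A \<in> carrier_mat k l \<Longrightarrow> A *\<^sub>v 0\<^sub>v l = 0\<^sub>v k"
  by (intro eq_vecI) (auto simp: scalar_prod_def)

lemma smult_zero_vec: "c \<cdot>\<^sub>v 0\<^sub>v n = (0\<^sub>v n :: 'a::mult_zero vec)"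
  by (intro eq_vecI) auto

lemma zero_mat_mult_vec: "v \<in> carrier_vec l \<Longrightarrow> 0\<^sub>m k l *\<^sub>v v = 0\<^sub>v k"
  by (intro eq_vecI) (auto simp: scalar_prod_def)

lemma mat_eq_if_mult_vec_eq:
  fixes A B :: "'a::comm_ring_1 mat"
  assumes "A \<in> carrier_mat k l" "B \<in> carrier_mat k l"
    and "\<And>v. v \<in> carrier_vec l \<Longrightarrow> A *\<^sub>v v = B *\<^sub>v v"
  shows "A = B"
proof (rule eq_matI)
  fix i j assume "i < dim_row B" "j < dim_col B"
  then have ij: "i < k" "j < l" using assms by auto
  have "(A *\<^sub>v unit_vec l j) $ i = (B *\<^sub>v unit_vec l j) $ i" using assms(3) by simp
  then show "A $$ (i, j) = B $$ (i, j)" using ij assms(1,2) by simp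
qed (use assms in auto)

section \<open>Representations, intertwiners and Schur's lemma\<close>

lemma GL_I:
  fixes A :: "'a::field mat"
  assumes "A \<in> carrier_mat n n" "B \<in> carrier_mat n n" "A * B = 1\<^sub>m n"
  shows "A \<in> carrier (GL n)"
  using assms mat_mult_left_right_inverse[OF assms] unfolding carrier_GL by auto

lemma GL_inv:
  fixes P :: "'a::field mat"
  assumes "P \<in> carrier (GL n)"
  shows "inv\<^bsub>GL n\<^esub> P \<in> carrier_mat n n" "P * inv\<^bsub>GL n\<^esub> P = 1\<^sub>m n" "inv\<^bsub>GL n\<^esub> P * P = 1\<^sub>m n"
proof -
  interpret G: group "GL n :: 'a mat monoid" by (rule group_GL)
  show "inv\<^bsub>GL n\<^esub> P \<in> carrier_mat n n" using G.inv_closed[OF assms] GL_carrier_mat by blast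
  show "P * inv\<^bsub>GL n\<^esub> P = 1\<^sub>m n" "inv\<^bsub>GL n\<^esub> P * P = 1\<^sub>m n"
    using G.r_inv[OF assms] G.l_inv[OF assms] by simp_all
qed

lemma Rep_carrier: "\<lbrakk>\<sigma> \<in> hom \<Gamma> (GL n); \<gamma> \<in> carrier \<Gamma>\<rbrakk> \<Longrightarrow> \<sigma> \<gamma> \<in> carrier_mat n n"
  by (auto simp: hom_def dest!: funcset_mem GL_carrier_mat)

lemma Rep_mult:
  "\<lbrakk>\<sigma> \<in> hom \<Gamma> (GL n); \<gamma> \<in> carrier \<Gamma>; \<delta> \<in> carrier \<Gamma>\<rbrakk> \<Longrightarrow> \<sigma> (\<gamma> \<otimes>\<^bsub>\<Gamma>\<^esub> \<delta>) = \<sigma> \<gamma> * \<sigma> \<delta>"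
  by (simp add: hom_def)

lemma Rep_one:
  assumes "group \<Gamma>" "\<sigma> \<in> hom \<Gamma> (GL n)"
  shows "\<sigma> \<one>\<^bsub>\<Gamma>\<^esub> = (1\<^sub>m n :: 'a::field mat)"
  using hom_one[OF assms(2,1) group_GL] by simp

lemma Rep_I:
  fixes \<sigma> :: "'g \<Rightarrow> 'a::field mat"
  assumes "group \<Gamma>" and carrier: "\<And>\<gamma>. \<gamma> \<in> carrier \<Gamma> \<Longrightarrow> \<sigma> \<gamma> \<in> carrier_mat n n"
    and mult: "\<And>\<gamma> \<delta>. \<lbrakk>\<gamma> \<in> carrier \<Gamma>; \<delta> \<in> carrier \<Gamma>\<rbrakk> \<Longrightarrow> \<sigma> (\<gamma> \<otimes>\<^bsub>\<Gamma>\<^esub> \<delta>) = \<sigma> \<gamma> * \<sigma> \<delta>"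
    and one: "\<sigma> \<one>\<^bsub>\<Gamma>\<^esub> = 1\<^sub>m n"
  shows "\<sigma> \<in> hom \<Gamma> (GL n)"
proof (rule homI)
  interpret group \<Gamma> by fact
  fix \<gamma> assume \<gamma>: "\<gamma> \<in> carrier \<Gamma>"
  have "\<sigma> \<gamma> * \<sigma> (inv\<^bsub>\<Gamma>\<^esub> \<gamma>) = 1\<^sub>m n" using mult[of \<gamma> "inv\<^bsub>\<Gamma>\<^esub> \<gamma>"] \<gamma> one by simp
  then show "\<sigma> \<gamma> \<in> carrier (GL n)" by (intro GL_I[of _ n "\<sigma> (inv\<^bsub>\<Gamma>\<^esub> \<gamma>)"] carrier \<gamma> inv_closed)
qed (use mult in simp)

definition invariant_subspace ::
  "('g, 'b) monoid_scheme \<Rightarrow> nat \<Rightarrow> ('g \<Rightarrow> complex mat) \<Rightarrow> complex vec set \<Rightarrow> bool" where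
  "invariant_subspace \<Gamma> n \<sigma> W \<longleftrightarrow>
     VectorSpace.subspace class_ring W (module_vec TYPE(complex) n) \<and>
     (\<forall>\<gamma>\<in>carrier \<Gamma>. \<forall>w\<in>W. \<sigma> \<gamma> *\<^sub>v w \<in> W)"

lemma subspace_vec_iff:
  "VectorSpace.subspace class_ring W (module_vec TYPE('a::field) n) \<longleftrightarrow>
     W \<subseteq> carrier_vec n \<and> 0\<^sub>v n \<in> W \<and> (\<forall>v\<in>W. \<forall>w\<in>W. v + w \<in> W) \<and> (\<forall>c. \<forall>v\<in>W. c \<cdot>\<^sub>v v \<in> W)"
  using vec_vs[where ?'a='a] vec_module[where ?'a='a]
  by (auto simp: VectorSpace.subspace_def submodule_def module_vec_simps)

lemma irreducible_rep_invariant_subspace: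
  assumes "irreducible_rep \<Gamma> n \<sigma>" "invariant_subspace \<Gamma> n \<sigma> W" "w \<in> W" "w \<noteq> 0\<^sub>v n"
  shows "W = carrier_vec n"
  using assms unfolding irreducible_rep_def invariant_subspace_def by blast

definition intertwiner :: "('g, 'b) monoid_scheme \<Rightarrow> nat \<Rightarrow> ('g \<Rightarrow> complex mat)
    \<Rightarrow> nat \<Rightarrow> ('g \<Rightarrow> complex mat) \<Rightarrow> complex mat \<Rightarrow> bool" where
  "intertwiner \<Gamma> k \<sigma> l \<tau> P \<longleftrightarrow>
     P \<in> carrier_mat l k \<and> (\<forall>\<gamma>\<in>carrier \<Gamma>. \<tau> \<gamma> * P = P * \<sigma> \<gamma>)"

definition equivalent_reps :: "('g, 'b) monoid_scheme \<Rightarrow> nat \<Rightarrow> ('g \<Rightarrow> complex mat)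
    \<Rightarrow> nat \<Rightarrow> ('g \<Rightarrow> complex mat) \<Rightarrow> bool" where
  "equivalent_reps \<Gamma> k \<sigma> l \<tau> \<longleftrightarrow> k = l \<and> (\<exists>P\<in>carrier (GL k). intertwiner \<Gamma> k \<sigma> k \<tau> P)"

lemma equivalent_repsI:
  assumes "P \<in> carrier_mat k k" "Q \<in> carrier_mat k k" "P * Q = 1\<^sub>m k"
    and "\<And>\<gamma>. \<gamma> \<in> carrier \<Gamma> \<Longrightarrow> \<tau> \<gamma> * P = P * \<sigma> \<gamma>"
  shows "equivalent_reps \<Gamma> k \<sigma> k \<tau>"
  using GL_I[OF assms(1-3)] assms by (auto simp: equivalent_reps_def intertwiner_def)

lemma equivalent_repsE:
  assumes "equivalent_reps \<Gamma> k \<sigma> l \<tau>"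
  obtains P Q where "l = k" "P \<in> carrier_mat k k" "Q \<in> carrier_mat k k" "P * Q = 1\<^sub>m k" "Q * P = 1\<^sub>m k"
    "\<And>\<gamma>. \<gamma> \<in> carrier \<Gamma> \<Longrightarrow> \<tau> \<gamma> * P = P * \<sigma> \<gamma>"
proof -
  from assms obtain P where P: "l = k" "P \<in> carrier (GL k)" "intertwiner \<Gamma> k \<sigma> k \<tau> P"
    by (auto simp: equivalent_reps_def)
  then show ?thesis using that[of P "inv\<^bsub>GL k\<^esub> P"] GL_inv[OF P(2)] by (auto simp: intertwiner_def)
qed

lemma equivalent_reps_refl:
  assumes "\<sigma> \<in> Rep \<Gamma> k"
  shows "equivalent_reps \<Gamma> k \<sigma> k \<sigma>"
proof (rule equivalent_repsI[of "1\<^sub>m k" k "1\<^sub>m k"])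
  fix \<gamma> assume "\<gamma> \<in> carrier \<Gamma>"
  from Rep_carrier[OF assms this] show "\<sigma> \<gamma> * 1\<^sub>m k = 1\<^sub>m k * \<sigma> \<gamma>" by simp
qed auto

lemma equivalent_reps_trans:
  assumes "\<sigma> \<in> Rep \<Gamma> k" "\<tau> \<in> Rep \<Gamma> l" "\<mu> \<in> Rep \<Gamma> m"
    and "equivalent_reps \<Gamma> k \<sigma> l \<tau>" "equivalent_reps \<Gamma> l \<tau> m \<mu>"
  shows "equivalent_reps \<Gamma> k \<sigma> m \<mu>"
proof -
  obtain P Q where l: "l = k" and P: "P \<in> carrier_mat k k" and Q: "Q \<in> carrier_mat k k"
    and PQ: "P * Q = 1\<^sub>m k" "Q * P = 1\<^sub>m k"
    and comm: "\<And>\<gamma>. \<gamma> \<in> carrier \<Gamma> \<Longrightarrow> \<tau> \<gamma> * P = P * \<sigma> \<gamma>"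
    using equivalent_repsE[OF assms(4)] by blast
  obtain P' Q' where m: "m = k" and P': "P' \<in> carrier_mat k k" and Q': "Q' \<in> carrier_mat k k"
    and PQ': "P' * Q' = 1\<^sub>m k" "Q' * P' = 1\<^sub>m k"
    and comm': "\<And>\<gamma>. \<gamma> \<in> carrier \<Gamma> \<Longrightarrow> \<mu> \<gamma> * P' = P' * \<tau> \<gamma>"
    using equivalent_repsE[OF assms(5)] l by metis
  have "equivalent_reps \<Gamma> k \<sigma> k \<mu>"
  proof (rule equivalent_repsI)
    show "P' * P \<in> carrier_mat k k" "Q * Q' \<in> carrier_mat k k" using P P' Q Q' by auto
    have "P' * P * (Q * Q') = P' * (P * Q) * Q'"
      using P P' Q Q' by (simp add: assoc_mult_mat[of _ k k _ k _ k])
    then show "P' * P * (Q * Q') = 1\<^sub>m k" using P' PQ PQ' by simp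
    fix \<gamma> assume \<gamma>: "\<gamma> \<in> carrier \<Gamma>"
    have c: "\<sigma> \<gamma> \<in> carrier_mat k k" "\<tau> \<gamma> \<in> carrier_mat k k" "\<mu> \<gamma> \<in> carrier_mat k k"
      using Rep_carrier[OF assms(1) \<gamma>] Rep_carrier[OF assms(2) \<gamma>] Rep_carrier[OF assms(3) \<gamma>] l m by auto
    have "\<mu> \<gamma> * (P' * P) = P' * (\<tau> \<gamma> * P)"
      using comm'[OF \<gamma>] assoc_mult_mat[OF c(3) P' P] assoc_mult_mat[OF P' c(2) P] by simp
    then show "\<mu> \<gamma> * (P' * P) = P' * P * \<sigma> \<gamma>"
      using comm[OF \<gamma>] assoc_mult_mat[OF P' P c(1)] by simp
  qed
  then show ?thesis by (simp add: m)
qed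

text \<open>
  The kernel and the image of \<open>P\<close> are invariant subspaces, so \<open>P\<close> is bijective; its inverse is
  obtained as the matrix of the inverse graph.
\<close>

lemma schur_lemma:
  assumes \<sigma>: "irreducible_rep \<Gamma> k \<sigma>" and \<tau>: "irreducible_rep \<Gamma> l \<tau>"
    and P: "intertwiner \<Gamma> k \<sigma> l \<tau> P" "P \<noteq> 0\<^sub>m l k"
  shows "k = l \<and> P \<in> carrier (GL k)"
proof -
  have Pc: "P \<in> carrier_mat l k" and comm: "\<And>\<gamma>. \<gamma> \<in> carrier \<Gamma> \<Longrightarrow> \<tau> \<gamma> * P = P * \<sigma> \<gamma>"
    using P by (auto simp: intertwiner_def)
  have \<sigma>c: "\<gamma> \<in> carrier \<Gamma> \<Longrightarrow> \<sigma> \<gamma> \<in> carrier_mat k k" for \<gamma>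
    using \<sigma> Rep_carrier by (auto simp: irreducible_rep_def)
  have \<tau>c: "\<gamma> \<in> carrier \<Gamma> \<Longrightarrow> \<tau> \<gamma> \<in> carrier_mat l l" for \<gamma>
    using \<tau> Rep_carrier by (auto simp: irreducible_rep_def)
  have move: "P *\<^sub>v (\<sigma> \<gamma> *\<^sub>v v) = \<tau> \<gamma> *\<^sub>v (P *\<^sub>v v)" if "\<gamma> \<in> carrier \<Gamma>" "v \<in> carrier_vec k" for \<gamma> v
    using comm[OF that(1)] assoc_mult_mat_vec[OF Pc \<sigma>c[OF that(1)] that(2)]
      assoc_mult_mat_vec[OF \<tau>c[OF that(1)] Pc that(2)] by simp
  obtain v where v: "v \<in> carrier_vec k" "P *\<^sub>v v \<noteq> 0\<^sub>v l"
  proof -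
    have "\<exists>v\<in>carrier_vec k. P *\<^sub>v v \<noteq> 0\<^sub>m l k *\<^sub>v v"
      using mat_eq_if_mult_vec_eq[OF Pc zero_carrier_mat] P(2) by blast
    then obtain v where "v \<in> carrier_vec k" "P *\<^sub>v v \<noteq> 0\<^sub>m l k *\<^sub>v v" by blast
    then show thesis using that[of v] by (simp add: zero_mat_mult_vec)
  qed
  let ?K = "{x \<in> carrier_vec k. P *\<^sub>v x = 0\<^sub>v l}"
  have "invariant_subspace \<Gamma> k \<sigma> ?K"
    unfolding invariant_subspace_def subspace_vec_iff
  proof (intro conjI ballI allI subsetI)
    fix \<gamma> x assume "\<gamma> \<in> carrier \<Gamma>" "x \<in> ?K"
    then show "\<sigma> \<gamma> *\<^sub>v x \<in> ?K" 
      using mult_mat_vec_carrier[OF \<sigma>c[of \<gamma>], of x] mult_mat_zero_vec[OF \<tau>c[of \<gamma>]] by (simp add: move)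
  qed (use Pc in \<open>auto simp: mult_add_distrib_mat_vec[OF Pc] mult_mat_vec[OF Pc]\<close>)
  then have injective: "x = 0\<^sub>v k" if "x \<in> ?K" for x
    using irreducible_rep_invariant_subspace[OF \<sigma> _ that] v by blast
  let ?I = "(\<lambda>x. P *\<^sub>v x) ` carrier_vec k"
  have "invariant_subspace \<Gamma> l \<tau> ?I"
    unfolding invariant_subspace_def subspace_vec_iff
  proof (intro conjI ballI allI subsetI)
    show "0\<^sub>v l \<in> ?I" using Pc by (intro image_eqI[of _ _ "0\<^sub>v k"]) auto
  next
    fix x y assume "x \<in> ?I" "y \<in> ?I"
    then show "x + y \<in> ?I" by (auto simp flip: mult_add_distrib_mat_vec[OF Pc])
  next
    fix c x assume "x \<in> ?I"
    then show "c \<cdot>\<^sub>v x \<in> ?I" by (auto simp flip: mult_mat_vec[OF Pc])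
  next
    fix \<gamma> x assume "\<gamma> \<in> carrier \<Gamma>" "x \<in> ?I"
    then show "\<tau> \<gamma> *\<^sub>v x \<in> ?I"
      using mult_mat_vec_carrier[OF \<sigma>c[of \<gamma>]] by (auto simp flip: move)
  qed (use Pc in auto)
  then have surjective: "?I = carrier_vec l"
    using irreducible_rep_invariant_subspace[OF \<tau>] v by blast
  obtain Q where Q: "Q \<in> carrier_mat k l"
    and "\<And>x y. (x, y) \<in> {(P *\<^sub>v x, x) |x. x \<in> carrier_vec k} \<Longrightarrow> y = Q *\<^sub>v x"
  proof (rule linear_relation_matrix[of "{(P *\<^sub>v x, x) |x. x \<in> carrier_vec k}" l k])
    show "\<exists>y. (x, y) \<in> {(P *\<^sub>v x, x) |x. x \<in> carrier_vec k}" if "x \<in> carrier_vec l" for x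
      using that unfolding surjective[symmetric] by auto
    show "y = 0\<^sub>v k" if "(0\<^sub>v l, y) \<in> {(P *\<^sub>v x, x) |x. x \<in> carrier_vec k}" for y
      using that injective by auto
  qed (use Pc in \<open>auto simp: mult_add_distrib_mat_vec[OF Pc] mult_mat_vec[OF Pc]\<close>)
  then have QP: "Q *\<^sub>v (P *\<^sub>v x) = x" if "x \<in> carrier_vec k" for x
    using that by fastforce
  have "Q * P = 1\<^sub>m k"
    using Pc Q QP by (intro mat_eq_if_mult_vec_eq[of _ k k]) (auto simp: assoc_mult_mat_vec[of _ k l])
  moreover have "P * Q = 1\<^sub>m l"
  proof (rule mat_eq_if_mult_vec_eq)
    fix y :: "complex vec" assume "y \<in> carrier_vec l"
    then obtain x where "x \<in> carrier_vec k" "y = P *\<^sub>v x" using surjective by blast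
    then show "P * Q *\<^sub>v y = 1\<^sub>m l *\<^sub>v y" using Pc Q QP by (simp add: assoc_mult_mat_vec[of _ l k])
  qed (use Pc Q in auto)
  \<comment> \<open>The traces of the two products are the two dimensions.\<close>
  ultimately have "k = l" using mat_trace_comm[OF Pc Q] by simp
  with \<open>P * Q = 1\<^sub>m l\<close> Pc Q show ?thesis by (auto intro: GL_I)
qed

text \<open>An eigenspace of \<open>P\<close> is an invariant subspace, hence everything.\<close>

lemma schur_scalar:
  assumes \<sigma>: "irreducible_rep \<Gamma> k \<sigma>" and P: "intertwiner \<Gamma> k \<sigma> k \<sigma> P"
  shows "\<exists>c. P = c \<cdot>\<^sub>m 1\<^sub>m k"
proof -
  have Pc: "P \<in> carrier_mat k k" and comm: "\<And>\<gamma>. \<gamma> \<in> carrier \<Gamma> \<Longrightarrow> \<sigma> \<gamma> * P = P * \<sigma> \<gamma>"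
    using P by (auto simp: intertwiner_def)
  have \<sigma>c: "\<gamma> \<in> carrier \<Gamma> \<Longrightarrow> \<sigma> \<gamma> \<in> carrier_mat k k" for \<gamma>
    using \<sigma> Rep_carrier by (auto simp: irreducible_rep_def)
  have "0 < k" using \<sigma> by (simp add: irreducible_rep_def)
  then obtain c where "eigenvalue P c"
    using spectrum_non_empty[OF Pc] by (auto simp: spectrum_def)
  then obtain v where v: "v \<in> carrier_vec k" "v \<noteq> 0\<^sub>v k" "P *\<^sub>v v = c \<cdot>\<^sub>v v"
    using Pc by (auto simp: eigenvalue_def eigenvector_def)
  let ?W = "{x \<in> carrier_vec k. P *\<^sub>v x = c \<cdot>\<^sub>v x}"
  have "invariant_subspace \<Gamma> k \<sigma> ?W"
    unfolding invariant_subspace_def subspace_vec_iff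
  proof (intro conjI ballI allI subsetI)
    fix \<gamma> x assume \<gamma>: "\<gamma> \<in> carrier \<Gamma>" and x: "x \<in> ?W"
    then have "P *\<^sub>v (\<sigma> \<gamma> *\<^sub>v x) = \<sigma> \<gamma> *\<^sub>v (P *\<^sub>v x)"
      using comm[OF \<gamma>] \<sigma>c[OF \<gamma>] Pc by (metis (no_types, lifting) assoc_mult_mat_vec mem_Collect_eq)
    then show "\<sigma> \<gamma> *\<^sub>v x \<in> ?W" using x \<sigma>c[OF \<gamma>] by (auto simp: mult_mat_vec)
  qed (use Pc in \<open>auto simp: mult_add_distrib_mat_vec[OF Pc] mult_mat_vec[OF Pc] smult_add_distrib_vec
      smult_smult_assoc mult.commute\<close>)
  then have "?W = carrier_vec k" using irreducible_rep_invariant_subspace[OF \<sigma>] v by blast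
  then have all: "P *\<^sub>v x = c \<cdot>\<^sub>v x" if "x \<in> carrier_vec k" for x using that by blast
  have "P = c \<cdot>\<^sub>m 1\<^sub>m k"
    using Pc by (intro mat_eq_if_mult_vec_eq[of _ k k]) (auto simp: all)
  then show ?thesis ..
qed

section \<open>The group algebra and linear independence of irreducible characters\<close>

text \<open>
  An element of the complex group algebra is written as a list of coefficients and group elements;
  two lists that stand for the same element act in the same way in every representation, so no
  quotient is needed.
\<close>

definition group_algebra :: "('g, 'b) monoid_scheme \<Rightarrow> (complex \<times> 'g) list set" where
  "group_algebra \<Gamma> = {a. snd ` set a \<subseteq> carrier \<Gamma>}"

fun alg_eval :: "nat \<Rightarrow> ('g \<Rightarrow> complex mat) \<Rightarrow> (complex \<times> 'g) list \<Rightarrow> complex mat" where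
  "alg_eval n \<sigma> [] = 0\<^sub>m n n"
| "alg_eval n \<sigma> ((c, \<gamma>) # a) = c \<cdot>\<^sub>m \<sigma> \<gamma> + alg_eval n \<sigma> a"

definition alg_scale :: "complex \<Rightarrow> (complex \<times> 'g) list \<Rightarrow> (complex \<times> 'g) list" where
  "alg_scale c a = map (\<lambda>(d, \<gamma>). (c * d, \<gamma>)) a"

definition alg_mult :: "('g, 'b) monoid_scheme
    \<Rightarrow> (complex \<times> 'g) list \<Rightarrow> (complex \<times> 'g) list \<Rightarrow> (complex \<times> 'g) list" where
  "alg_mult \<Gamma> a b = concat (map (\<lambda>(c, \<gamma>). map (\<lambda>(d, \<delta>). (c * d, \<gamma> \<otimes>\<^bsub>\<Gamma>\<^esub> \<delta>)) b) a)"

lemma group_algebra_Nil [simp]: "[] \<in> group_algebra \<Gamma>"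
  and group_algebra_Cons [simp]:
    "(c, \<gamma>) # a \<in> group_algebra \<Gamma> \<longleftrightarrow> \<gamma> \<in> carrier \<Gamma> \<and> a \<in> group_algebra \<Gamma>"
  and group_algebra_append [simp]:
    "a @ b \<in> group_algebra \<Gamma> \<longleftrightarrow> a \<in> group_algebra \<Gamma> \<and> b \<in> group_algebra \<Gamma>"
  by (auto simp: group_algebra_def)

lemma alg_scale_closed [simp]: "a \<in> group_algebra \<Gamma> \<Longrightarrow> alg_scale c a \<in> group_algebra \<Gamma>"
  by (force simp: group_algebra_def alg_scale_def)

lemma alg_mult_simps:
  "alg_mult \<Gamma> [] b = []"
  "alg_mult \<Gamma> ((c, \<gamma>) # a) b = map (\<lambda>(d, \<delta>). (c * d, \<gamma> \<otimes>\<^bsub>\<Gamma>\<^esub> \<delta>)) b @ alg_mult \<Gamma> a b"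
  by (simp_all add: alg_mult_def)

lemma alg_translate_closed:
  assumes "group \<Gamma>" "\<gamma> \<in> carrier \<Gamma>" "b \<in> group_algebra \<Gamma>"
  shows "map (\<lambda>(d, \<delta>). (c * d, \<gamma> \<otimes>\<^bsub>\<Gamma>\<^esub> \<delta>)) b \<in> group_algebra \<Gamma>"
  using assms(3)
proof (induction b)
  case (Cons x b)
  interpret group \<Gamma> by fact
  from Cons assms(2) show ?case by (cases x) simp
qed simp

lemma alg_mult_closed:
  assumes "group \<Gamma>" "a \<in> group_algebra \<Gamma>" "b \<in> group_algebra \<Gamma>"
  shows "alg_mult \<Gamma> a b \<in> group_algebra \<Gamma>"
  using assms(2)
proof (induction a)
  case (Cons x a)
  then show ?case by (cases x) (simp add: alg_mult_simps alg_translate_closed assms)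
qed (simp add: alg_mult_simps)

lemma alg_eval_carrier [simp]:
  assumes "\<sigma> \<in> Rep \<Gamma> n" "a \<in> group_algebra \<Gamma>"
  shows "alg_eval n \<sigma> a \<in> carrier_mat n n"
  using assms(2)
proof (induction a)
  case (Cons x a)
  then show ?case using Rep_carrier[OF assms(1)] by (cases x) simp
qed simp

lemma alg_eval_append:
  assumes \<sigma>: "\<sigma> \<in> Rep \<Gamma> n" and "a \<in> group_algebra \<Gamma>" "b \<in> group_algebra \<Gamma>"
  shows "alg_eval n \<sigma> (a @ b) = alg_eval n \<sigma> a + alg_eval n \<sigma> b"
  using assms(2)
proof (induction a)
  case Nil
  then show ?case using alg_eval_carrier[OF \<sigma> assms(3)] by simp
next
  case (Cons x a)
  obtain c \<gamma> where x: "x = (c, \<gamma>)" by (cases x)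
  have "\<sigma> \<gamma> \<in> carrier_mat n n" using Cons.prems Rep_carrier[OF \<sigma>] by (simp add: x)
  with Cons show ?case
    using alg_eval_carrier[OF \<sigma>, of a] alg_eval_carrier[OF \<sigma> assms(3)]
    by (simp add: x assoc_add_mat[of _ n n])
qed

lemma alg_eval_scale:
  assumes \<sigma>: "\<sigma> \<in> Rep \<Gamma> n" and "a \<in> group_algebra \<Gamma>"
  shows "alg_eval n \<sigma> (alg_scale c a) = c \<cdot>\<^sub>m alg_eval n \<sigma> a"
  using assms(2)
proof (induction a)
  case (Cons x a)
  obtain d \<gamma> where x: "x = (d, \<gamma>)" by (cases x)
  have "\<sigma> \<gamma> \<in> carrier_mat n n" using Cons.prems Rep_carrier[OF \<sigma>] by (simp add: x)
  with Cons show ?case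
    using alg_eval_carrier[OF \<sigma>, of a]
    by (simp add: x alg_scale_def add_smult_distrib_left_mat[of _ n n] smult_smult_mat)
qed (simp add: alg_scale_def)

lemma alg_eval_mult:
  assumes "group \<Gamma>" and \<sigma>: "\<sigma> \<in> Rep \<Gamma> n" and a: "a \<in> group_algebra \<Gamma>" and b: "b \<in> group_algebra \<Gamma>"
  shows "alg_eval n \<sigma> (alg_mult \<Gamma> a b) = alg_eval n \<sigma> a * alg_eval n \<sigma> b"
proof -
  have translate: "alg_eval n \<sigma> (map (\<lambda>(d, \<delta>). (c * d, \<gamma> \<otimes>\<^bsub>\<Gamma>\<^esub> \<delta>)) b) = (c \<cdot>\<^sub>m \<sigma> \<gamma>) * alg_eval n \<sigma> b"
    if \<gamma>: "\<gamma> \<in> carrier \<Gamma>" for c \<gamma>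
    using b
  proof (induction b)
    case Nil
    then show ?case using Rep_carrier[OF \<sigma> \<gamma>] by simp
  next
    case (Cons x b)
    obtain d \<delta> where x: "x = (d, \<delta>)" by (cases x)
    have "\<sigma> \<delta> \<in> carrier_mat n n" using Cons.prems Rep_carrier[OF \<sigma>] by (simp add: x)
    with Cons show ?case
      using alg_eval_carrier[OF \<sigma>, of b] Rep_carrier[OF \<sigma> \<gamma>] Rep_mult[OF \<sigma> \<gamma>, of \<delta>]
      by (simp add: x mult_add_distrib_mat[of _ n n _ n] add_smult_distrib_left_mat[of _ n n] mult_smult_assoc_mat[of _ n n _ n]
          mult_smult_distrib[of _ n n _ n] smult_smult_mat mult.commute)
  qed
  show ?thesis
    using a
  proof (induction a)
    case Nil
    then show ?case using alg_eval_carrier[OF \<sigma> b] by (simp add: alg_mult_simps)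
  next
    case (Cons x a)
    obtain c \<gamma> where x: "x = (c, \<gamma>)" by (cases x)
    have \<gamma>: "\<gamma> \<in> carrier \<Gamma>" and a: "a \<in> group_algebra \<Gamma>" using Cons.prems by (auto simp: x)
    show ?case
      unfolding x alg_mult_simps
      using alg_eval_append[OF \<sigma> alg_translate_closed[OF assms(1) \<gamma> b] alg_mult_closed[OF assms(1) a b]]
        translate[OF \<gamma>] Cons.IH[OF a] Rep_carrier[OF \<sigma> \<gamma>] alg_eval_carrier[OF \<sigma> a] alg_eval_carrier[OF \<sigma> b]
      by (simp add: add_mult_distrib_mat[of _ n n])
  qed
qed

lemma alg_eval_one:
  assumes "group \<Gamma>" "\<sigma> \<in> Rep \<Gamma> n"
  shows "alg_eval n \<sigma> [(1, \<one>\<^bsub>\<Gamma>\<^esub>)] = 1\<^sub>m n"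
  using Rep_one[OF assms] by (simp add: one_smult_mat)

lemma alg_power:
  assumes "group \<Gamma>" "a \<in> group_algebra \<Gamma>"
  obtains b where "b \<in> group_algebra \<Gamma>"
    "\<And>n \<sigma>. \<sigma> \<in> Rep \<Gamma> n \<Longrightarrow> alg_eval n \<sigma> b = alg_eval n \<sigma> a ^\<^sub>m m"
proof -
  have "\<exists>b\<in>group_algebra \<Gamma>. \<forall>n. \<forall>\<sigma>\<in>Rep \<Gamma> n. alg_eval n \<sigma> b = alg_eval n \<sigma> a ^\<^sub>m m"
  proof (induction m)
    case 0
    interpret group \<Gamma> by fact
    have "dim_row (alg_eval n \<sigma> a) = n" if "\<sigma> \<in> Rep \<Gamma> n" for n \<sigma>
      using alg_eval_carrier[OF that assms(2)] by simp
    then show ?case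
      by (intro bexI[of _ "[(1, \<one>\<^bsub>\<Gamma>\<^esub>)]"]) (simp_all add: alg_eval_one[OF assms(1)] del: alg_eval.simps)
  next
    case (Suc m)
    then obtain b where "b \<in> group_algebra \<Gamma>"
      "\<forall>n. \<forall>\<sigma>\<in>Rep \<Gamma> n. alg_eval n \<sigma> b = alg_eval n \<sigma> a ^\<^sub>m m" by blast
    then show ?case
      using assms by (intro bexI[of _ "alg_mult \<Gamma> b a"]) (simp_all add: alg_eval_mult alg_mult_closed)
  qed
  then show ?thesis using that by blast
qed

lemma intertwiner_alg_eval:
  assumes \<sigma>: "\<sigma> \<in> Rep \<Gamma> k" and \<tau>: "\<tau> \<in> Rep \<Gamma> l" and P: "intertwiner \<Gamma> k \<sigma> l \<tau> P"
    and a: "a \<in> group_algebra \<Gamma>"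
  shows "alg_eval l \<tau> a * P = P * alg_eval k \<sigma> a"
  using a
proof (induction a)
  case (Cons x a)
  obtain c \<gamma> where x: "x = (c, \<gamma>)" by (cases x)
  have \<gamma>: "\<gamma> \<in> carrier \<Gamma>" and a: "a \<in> group_algebra \<Gamma>" using Cons.prems by (auto simp: x)
  have Pc: "P \<in> carrier_mat l k" and comm: "\<tau> \<gamma> * P = P * \<sigma> \<gamma>" using P \<gamma> by (auto simp: intertwiner_def)
  show ?case
    using comm Cons.IH[OF a] Pc Rep_carrier[OF \<sigma> \<gamma>] Rep_carrier[OF \<tau> \<gamma>] alg_eval_carrier[OF \<sigma> a]
      alg_eval_carrier[OF \<tau> a]
    by (simp add: x add_mult_distrib_mat[of _ l l _ _ k] mult_add_distrib_mat[of _ l k _ k]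
        mult_smult_assoc_mat[of _ l l _ k] mult_smult_distrib[of _ l k _ k])
qed (use P in \<open>auto simp: intertwiner_def\<close>)

lemma mat_trace_alg_eval:
  assumes \<sigma>: "\<sigma> \<in> Rep \<Gamma> n" and a: "a \<in> group_algebra \<Gamma>"
  shows "mat_trace (alg_eval n \<sigma> a) = (\<Sum>(c, \<gamma>)\<leftarrow>a. c * mat_trace (\<sigma> \<gamma>))"
  using a
proof (induction a)
  case (Cons x a)
  obtain c \<gamma> where x: "x = (c, \<gamma>)" by (cases x)
  have \<gamma>: "\<gamma> \<in> carrier \<Gamma>" and a: "a \<in> group_algebra \<Gamma>" using Cons.prems by (auto simp: x)
  show ?case
    using Cons.IH[OF a] Rep_carrier[OF \<sigma> \<gamma>] alg_eval_carrier[OF \<sigma> a]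
    by (simp add: x mat_trace_add[of _ n] mat_trace_smult)
qed simp

text \<open>
  In an irreducible representation every nonzero vector is cyclic, since its orbit under the group
  algebra, or under any left ideal that does not annihilate it, is a nonzero invariant subspace.
\<close>

lemma left_ideal_orbit:
  assumes "group \<Gamma>" and \<sigma>: "irreducible_rep \<Gamma> k \<sigma>" and v: "v \<in> carrier_vec k"
    and I: "I \<subseteq> group_algebra \<Gamma>" "\<And>a b. \<lbrakk>a \<in> I; b \<in> I\<rbrakk> \<Longrightarrow> a @ b \<in> I"
      "\<And>a b. \<lbrakk>a \<in> group_algebra \<Gamma>; b \<in> I\<rbrakk> \<Longrightarrow> alg_mult \<Gamma> a b \<in> I"
    and a: "a \<in> I" "alg_eval k \<sigma> a *\<^sub>v v \<noteq> 0\<^sub>v k" and w: "w \<in> carrier_vec k"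
  obtains b where "b \<in> I" "alg_eval k \<sigma> b *\<^sub>v v = w"
proof -
  interpret group \<Gamma> by fact
  have R: "\<sigma> \<in> Rep \<Gamma> k" using \<sigma> by (simp add: irreducible_rep_def)
  let ?W = "(\<lambda>b. alg_eval k \<sigma> b *\<^sub>v v) ` I"
  have carrier: "alg_eval k \<sigma> b \<in> carrier_mat k k" if "b \<in> I" for b
    using alg_eval_carrier[OF R] I(1) that by blast
  have translate: "(c \<cdot>\<^sub>m \<sigma> \<gamma>) *\<^sub>v x \<in> ?W" if "\<gamma> \<in> carrier \<Gamma>" "x \<in> ?W" for c \<gamma> x
  proof -
    obtain b where b: "b \<in> I" "x = alg_eval k \<sigma> b *\<^sub>v v" using \<open>x \<in> ?W\<close> by blast
    have "alg_eval k \<sigma> [(c, \<gamma>)] = c \<cdot>\<^sub>m \<sigma> \<gamma>" using Rep_carrier[OF R that(1)] by simp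
    then have "alg_eval k \<sigma> (alg_mult \<Gamma> [(c, \<gamma>)] b) *\<^sub>v v = (c \<cdot>\<^sub>m \<sigma> \<gamma>) *\<^sub>v x"
      using alg_eval_mult[OF assms(1) R, of "[(c, \<gamma>)]" b] b I(1) that(1) carrier v Rep_carrier[OF R that(1)]
      by (auto simp: assoc_mult_mat_vec[of _ k k _ k])
    moreover have "alg_mult \<Gamma> [(c, \<gamma>)] b \<in> I" using I(3) b that by simp
    ultimately show ?thesis by (metis image_eqI)
  qed
  have smult: "c \<cdot>\<^sub>v x \<in> ?W" if "x \<in> ?W" for c x
  proof -
    have "x \<in> carrier_vec k" using that v mult_mat_vec_carrier[OF carrier] by auto
    then have "(c \<cdot>\<^sub>m \<sigma> \<one>\<^bsub>\<Gamma>\<^esub>) *\<^sub>v x = c \<cdot>\<^sub>v x"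
      using Rep_one[OF assms(1) R] by (simp add: smult_mat_mult_vec[of _ k k])
    then show ?thesis using translate[OF one_closed that, of c] by simp
  qed
  have "invariant_subspace \<Gamma> k \<sigma> ?W"
    unfolding invariant_subspace_def subspace_vec_iff
  proof (intro conjI ballI allI subsetI)
    show "x \<in> carrier_vec k" if "x \<in> ?W" for x using that v mult_mat_vec_carrier[OF carrier] by auto
    have "0 \<cdot>\<^sub>v (alg_eval k \<sigma> a *\<^sub>v v) \<in> ?W" using smult a(1) by blast
    moreover have "0 \<cdot>\<^sub>v (alg_eval k \<sigma> a *\<^sub>v v) = 0\<^sub>v k"
      using carrier[OF a(1)] by (intro eq_vecI) auto
    ultimately show "0\<^sub>v k \<in> ?W" by metis
    show "c \<cdot>\<^sub>v x \<in> ?W" if "x \<in> ?W" for c x using smult that .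
    show "x + y \<in> ?W" if xy: "x \<in> ?W" "y \<in> ?W" for x y
    proof -
      obtain b where b: "b \<in> I" "x = alg_eval k \<sigma> b *\<^sub>v v" using xy(1) by (rule imageE)
      obtain c where c: "c \<in> I" "y = alg_eval k \<sigma> c *\<^sub>v v" using xy(2) by (rule imageE)
      have "alg_eval k \<sigma> (b @ c) = alg_eval k \<sigma> b + alg_eval k \<sigma> c"
        using b c I(1) by (intro alg_eval_append[OF R]) auto
      then have "alg_eval k \<sigma> (b @ c) *\<^sub>v v = x + y"
        using b c v add_mult_distrib_mat_vec[OF carrier carrier] by simp
      then show ?thesis using I(2) b c by (metis image_eqI)
    qed
    show "\<sigma> \<gamma> *\<^sub>v x \<in> ?W" if "\<gamma> \<in> carrier \<Gamma>" "x \<in> ?W" for \<gamma> x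
      using translate[OF that, of 1] by (simp add: one_smult_mat)
  qed
  then have "?W = carrier_vec k" 
    using irreducible_rep_invariant_subspace[OF \<sigma> _ _ a(2)] a(1) by simp
  with w have "w \<in> ?W" by simp
  then obtain b where "w = alg_eval k \<sigma> b *\<^sub>v v" "b \<in> I" by (rule imageE)
  then show ?thesis using that[of b] by simp
qed

text \<open>
  The next lemma is the part of the Jacobson density theorem that is used here.  Vectors are
  annihilated one after the other.  Let \<open>I\<close> be the left ideal that annihilates the vectors treated
  so far.  If annihilating a further vector \<open>v\<close> of \<open>\<tau>\<close> forced \<open>w\<close> to be annihilated, then sending
  \<open>b v\<close> to \<open>b w\<close> for \<open>b\<close> in \<open>I\<close> would define a nonzero intertwiner from \<open>\<tau>\<close> to \<open>\<sigma>\<close>, and by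
  Schur's lemma the two representations would be equivalent.
\<close>

lemma annihilate_inequivalent_vectors:
  assumes G: "group \<Gamma>" and \<sigma>: "irreducible_rep \<Gamma> k \<sigma>" and w: "w \<in> carrier_vec k" "w \<noteq> 0\<^sub>v k"
    and "\<And>l \<tau> v. (l, \<tau>, v) \<in> set xs \<Longrightarrow>
      irreducible_rep \<Gamma> l \<tau> \<and> v \<in> carrier_vec l \<and> \<not> equivalent_reps \<Gamma> l \<tau> k \<sigma>"
  shows "\<exists>a\<in>group_algebra \<Gamma>. (\<forall>(l, \<tau>, v)\<in>set xs. alg_eval l \<tau> a *\<^sub>v v = 0\<^sub>v l) \<and>
      alg_eval k \<sigma> a *\<^sub>v w \<noteq> 0\<^sub>v k"
  using assms(5)
proof (induction xs)
  case Nil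
  interpret group \<Gamma> by fact
  have "\<sigma> \<in> Rep \<Gamma> k" using \<sigma> by (simp add: irreducible_rep_def)
  then show ?case using w
    by (intro bexI[of _ "[(1, \<one>\<^bsub>\<Gamma>\<^esub>)]"]) (simp_all add: alg_eval_one[OF G] del: alg_eval.simps)
next
  case (Cons x xs)
  obtain l \<tau> v where x: "x = (l, \<tau>, v)" by (cases x)
  have \<tau>: "irreducible_rep \<Gamma> l \<tau>" and v: "v \<in> carrier_vec l" and ineq: "\<not> equivalent_reps \<Gamma> l \<tau> k \<sigma>"
    using Cons.prems[of l \<tau> v] by (auto simp: x)
  have R\<sigma>: "\<sigma> \<in> Rep \<Gamma> k" and R\<tau>: "\<tau> \<in> Rep \<Gamma> l" using \<sigma> \<tau> by (auto simp: irreducible_rep_def)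
  define I where "I = {a \<in> group_algebra \<Gamma>. \<forall>(l, \<tau>, v)\<in>set xs. alg_eval l \<tau> a *\<^sub>v v = 0\<^sub>v l}"
  obtain a0 where a0: "a0 \<in> I" "alg_eval k \<sigma> a0 *\<^sub>v w \<noteq> 0\<^sub>v k"
    using Cons unfolding I_def by auto
  have sub: "I \<subseteq> group_algebra \<Gamma>" by (auto simp: I_def)
  have rest: "irreducible_rep \<Gamma> m \<mu>" "\<mu> \<in> Rep \<Gamma> m" "u \<in> carrier_vec m" if "(m, \<mu>, u) \<in> set xs" for m \<mu> u
    using Cons.prems[of m \<mu> u] that by (auto simp: irreducible_rep_def)
  have append: "a @ b \<in> I" if "a \<in> I" "b \<in> I" for a b
  proof -
    have "alg_eval m \<mu> (a @ b) *\<^sub>v u = 0\<^sub>v m" if u: "(m, \<mu>, u) \<in> set xs" for m \<mu> u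
    proof -
      have ab: "a \<in> group_algebra \<Gamma>" "b \<in> group_algebra \<Gamma>"
        "alg_eval m \<mu> a *\<^sub>v u = 0\<^sub>v m" "alg_eval m \<mu> b *\<^sub>v u = 0\<^sub>v m"
        using \<open>a \<in> I\<close> \<open>b \<in> I\<close> u by (auto simp: I_def)
      then show ?thesis
        using rest[OF u] alg_eval_carrier[of \<mu>] by (simp add: alg_eval_append add_mult_distrib_mat_vec[of _ m m])
    qed
    then show ?thesis using that by (auto simp: I_def)
  qed
  have mult: "alg_mult \<Gamma> a b \<in> I" if a: "a \<in> group_algebra \<Gamma>" and b: "b \<in> I" for a b
  proof -
    have "alg_eval m \<mu> (alg_mult \<Gamma> a b) *\<^sub>v u = 0\<^sub>v m" if u: "(m, \<mu>, u) \<in> set xs" for m \<mu> u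
    proof -
      have b': "b \<in> group_algebra \<Gamma>" "alg_eval m \<mu> b *\<^sub>v u = 0\<^sub>v m"
        using b u by (auto simp: I_def)
      then show ?thesis
        using rest[OF u] a alg_eval_carrier[OF rest(2)[OF u]]
        by (simp add: alg_eval_mult[OF G] assoc_mult_mat_vec[of _ m m _ m] mult_mat_zero_vec)
    qed
    then show ?thesis using a b alg_mult_closed[OF G] by (auto simp: I_def)
  qed
  have scale: "alg_scale c b \<in> I" if b: "b \<in> I" for c b
  proof -
    have "alg_eval m \<mu> (alg_scale c b) *\<^sub>v u = 0\<^sub>v m" if u: "(m, \<mu>, u) \<in> set xs" for m \<mu> u
    proof -
      have b': "b \<in> group_algebra \<Gamma>" "alg_eval m \<mu> b *\<^sub>v u = 0\<^sub>v m"
        using b u by (auto simp: I_def)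
      then show ?thesis
        using rest[OF u] alg_eval_carrier[OF rest(2)[OF u]]
        by (simp add: alg_eval_scale smult_mat_mult_vec[of _ m m] smult_zero_vec)
    qed
    then show ?thesis using b by (auto simp: I_def)
  qed
  have carrier_\<sigma>: "alg_eval k \<sigma> b \<in> carrier_mat k k" and carrier_\<tau>: "alg_eval l \<tau> b \<in> carrier_mat l l"
    if "b \<in> I" for b
    using alg_eval_carrier[OF R\<sigma>] alg_eval_carrier[OF R\<tau>] sub that by auto
  show ?case
  proof (rule ccontr)
    assume contra: "\<not> ?case"
    have forced: "alg_eval k \<sigma> b *\<^sub>v w = 0\<^sub>v k" if "b \<in> I" "alg_eval l \<tau> b *\<^sub>v v = 0\<^sub>v l" for b
      using contra that by (auto simp: I_def x)
    have "alg_eval l \<tau> a0 *\<^sub>v v \<noteq> 0\<^sub>v l" using forced a0 by blast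
    then have cyclic: "\<exists>b\<in>I. alg_eval l \<tau> b *\<^sub>v v = y" if "y \<in> carrier_vec l" for y
      using left_ideal_orbit[OF G \<tau> v sub append mult a0(1) _ that] by blast
    let ?R = "{(alg_eval l \<tau> b *\<^sub>v v, alg_eval k \<sigma> b *\<^sub>v w) |b. b \<in> I}"
    obtain P where P: "P \<in> carrier_mat k l" and "\<And>y z. (y, z) \<in> ?R \<Longrightarrow> z = P *\<^sub>v y"
    proof (rule linear_relation_matrix[of ?R l k])
      show "?R \<subseteq> carrier_vec l \<times> carrier_vec k"
        using v w mult_mat_vec_carrier[OF carrier_\<tau>] mult_mat_vec_carrier[OF carrier_\<sigma>] by auto
      show "\<exists>z. (y, z) \<in> ?R" if "y \<in> carrier_vec l" for y using cyclic[OF that] by auto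
      show "z = 0\<^sub>v k" if "(0\<^sub>v l, z) \<in> ?R" for z using that forced by auto
      show "(y + y', z + z') \<in> ?R" if yz: "(y, z) \<in> ?R" "(y', z') \<in> ?R" for y z y' z'
      proof -
        obtain b b' where b: "b \<in> I" "y = alg_eval l \<tau> b *\<^sub>v v" "z = alg_eval k \<sigma> b *\<^sub>v w"
          and b': "b' \<in> I" "y' = alg_eval l \<tau> b' *\<^sub>v v" "z' = alg_eval k \<sigma> b' *\<^sub>v w"
          using yz by blast
        have "b \<in> group_algebra \<Gamma>" "b' \<in> group_algebra \<Gamma>" using b b' sub by auto
        then have "alg_eval l \<tau> (b @ b') *\<^sub>v v = y + y'" "alg_eval k \<sigma> (b @ b') *\<^sub>v w = z + z'"
          using b b' v w(1) add_mult_distrib_mat_vec[OF carrier_\<tau> carrier_\<tau>]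
            add_mult_distrib_mat_vec[OF carrier_\<sigma> carrier_\<sigma>]
          by (simp_all add: alg_eval_append[OF R\<sigma>] alg_eval_append[OF R\<tau>])
        then show ?thesis using append[OF b(1) b'(1)] by (intro CollectI exI[of _ "b @ b'"]) simp
      qed
      show "(c \<cdot>\<^sub>v y, c \<cdot>\<^sub>v z) \<in> ?R" if yz: "(y, z) \<in> ?R" for c y z
      proof -
        obtain b where b: "b \<in> I" "y = alg_eval l \<tau> b *\<^sub>v v" "z = alg_eval k \<sigma> b *\<^sub>v w"
          using yz by blast
        have "b \<in> group_algebra \<Gamma>" using b sub by auto
        then have "alg_eval l \<tau> (alg_scale c b) *\<^sub>v v = c \<cdot>\<^sub>v y" "alg_eval k \<sigma> (alg_scale c b) *\<^sub>v w = c \<cdot>\<^sub>v z"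
          using b v w(1) smult_mat_mult_vec[OF carrier_\<tau>] smult_mat_mult_vec[OF carrier_\<sigma>]
          by (simp_all add: alg_eval_scale[OF R\<sigma>] alg_eval_scale[OF R\<tau>])
        then show ?thesis using scale[OF b(1)] by (intro CollectI exI[of _ "alg_scale c b"]) simp
      qed
    qed (rule that)
    then have graph: "P *\<^sub>v (alg_eval l \<tau> b *\<^sub>v v) = alg_eval k \<sigma> b *\<^sub>v w" if "b \<in> I" for b
      using that by fastforce
    have "\<sigma> \<gamma> * P = P * \<tau> \<gamma>" if \<gamma>: "\<gamma> \<in> carrier \<Gamma>" for \<gamma>
    proof (rule mat_eq_if_mult_vec_eq)
      have c: "\<sigma> \<gamma> \<in> carrier_mat k k" "\<tau> \<gamma> \<in> carrier_mat l l"
        using Rep_carrier[OF R\<sigma> \<gamma>] Rep_carrier[OF R\<tau> \<gamma>] .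
      show "\<sigma> \<gamma> * P \<in> carrier_mat k l" "P * \<tau> \<gamma> \<in> carrier_mat k l" using P c by auto
      fix y :: "complex vec" assume "y \<in> carrier_vec l"
      then obtain b where b: "b \<in> I" "y = alg_eval l \<tau> b *\<^sub>v v" using cyclic by blast
      let ?b = "alg_mult \<Gamma> [(1, \<gamma>)] b"
      have bI: "?b \<in> I" using mult b(1) \<gamma> by simp
      have bG: "b \<in> group_algebra \<Gamma>" using b sub by auto
      have "alg_eval l \<tau> ?b *\<^sub>v v = \<tau> \<gamma> *\<^sub>v y"
        using alg_eval_mult[OF G R\<tau> _ bG, of "[(1, \<gamma>)]"] \<gamma> b v c carrier_\<tau>
        by (simp add: one_smult_mat assoc_mult_mat_vec[of _ l l _ l])
      moreover have "alg_eval k \<sigma> ?b *\<^sub>v w = \<sigma> \<gamma> *\<^sub>v (P *\<^sub>v y)"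
        using alg_eval_mult[OF G R\<sigma> _ bG, of "[(1, \<gamma>)]"] \<gamma> b w(1) c carrier_\<sigma> graph[OF b(1)]
        by (simp add: one_smult_mat assoc_mult_mat_vec[of _ k k _ k])
      ultimately show "\<sigma> \<gamma> * P *\<^sub>v y = P * \<tau> \<gamma> *\<^sub>v y"
        using graph[OF bI] P c \<open>y \<in> carrier_vec l\<close>
        by (simp add: assoc_mult_mat_vec[of _ k k _ l] assoc_mult_mat_vec[of _ k l _ l])
    qed
    then have "intertwiner \<Gamma> l \<tau> k \<sigma> P" using P by (simp add: intertwiner_def)
    moreover have "P \<noteq> 0\<^sub>m k l"
      using graph[OF a0(1)] a0(2) mult_mat_vec_carrier[OF carrier_\<tau>[OF a0(1)] v]
      by (auto simp: zero_mat_mult_vec)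
    ultimately have "equivalent_reps \<Gamma> l \<tau> k \<sigma>"
      using schur_lemma[OF \<tau> \<sigma>, of P] by (auto simp: equivalent_reps_def)
    with ineq show False by contradiction
  qed
qed

text \<open>
  Annihilating all unit vectors of a representation annihilates the representation; cyclicity then
  allows the remaining action on \<open>\<sigma>\<close> to be corrected so that it has the eigenvalue \<open>1\<close>.
\<close>

lemma annihilate_inequivalent_reps:
  assumes G: "group \<Gamma>" and \<sigma>: "irreducible_rep \<Gamma> k \<sigma>"
    and N: "\<And>l \<tau>. (l, \<tau>) \<in> set N \<Longrightarrow> irreducible_rep \<Gamma> l \<tau> \<and> \<not> equivalent_reps \<Gamma> l \<tau> k \<sigma>"
  obtains a w where "a \<in> group_algebra \<Gamma>" "\<And>l \<tau>. (l, \<tau>) \<in> set N \<Longrightarrow> alg_eval l \<tau> a = 0\<^sub>m l l"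
    "w \<in> carrier_vec k" "w \<noteq> 0\<^sub>v k" "alg_eval k \<sigma> a *\<^sub>v w = w"
proof -
  interpret group \<Gamma> by fact
  have R: "\<sigma> \<in> Rep \<Gamma> k" and k: "0 < k" using \<sigma> by (auto simp: irreducible_rep_def)
  define w :: "complex vec" where "w = unit_vec k 0"
  have w: "w \<in> carrier_vec k" "w \<noteq> 0\<^sub>v k" using k by (auto simp: w_def)
  obtain a where a: "a \<in> group_algebra \<Gamma>"
    and kill: "\<forall>(l, \<tau>, v)\<in>set [(l, \<tau>, unit_vec l i). (l, \<tau>) \<leftarrow> N, i \<leftarrow> [0..<l]]. alg_eval l \<tau> a *\<^sub>v v = 0\<^sub>v l"
    and nonzero: "alg_eval k \<sigma> a *\<^sub>v w \<noteq> 0\<^sub>v k"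
    using annihilate_inequivalent_vectors[OF G \<sigma> w,
        of "[(l, \<tau>, unit_vec l i). (l, \<tau>) \<leftarrow> N, i \<leftarrow> [0..<l]]"] N by fastforce
  have ac: "alg_eval k \<sigma> a \<in> carrier_mat k k" using alg_eval_carrier[OF R a] .
  define v where "v = alg_eval k \<sigma> a *\<^sub>v w"
  have v: "v \<in> carrier_vec k" "v \<noteq> 0\<^sub>v k" using ac w nonzero by (auto simp: v_def)
  obtain b where b: "b \<in> group_algebra \<Gamma>" "alg_eval k \<sigma> b *\<^sub>v v = w"
  proof (rule left_ideal_orbit[OF G \<sigma> v(1), of "group_algebra \<Gamma>" "[(1, \<one>\<^bsub>\<Gamma>\<^esub>)]" w])
    show "alg_eval k \<sigma> [(1, \<one>\<^bsub>\<Gamma>\<^esub>)] *\<^sub>v v \<noteq> 0\<^sub>v k"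
      using v by (simp add: alg_eval_one[OF G R] del: alg_eval.simps)
  qed (use w in \<open>auto simp: alg_mult_closed[OF G]\<close>)
  let ?c = "alg_mult \<Gamma> b a"
  show ?thesis
  proof (rule that)
    show "?c \<in> group_algebra \<Gamma>" using alg_mult_closed[OF G b(1) a] .
    show "alg_eval k \<sigma> ?c *\<^sub>v w = w"
      using b a w ac alg_eval_carrier[OF R b(1)]
      by (simp add: alg_eval_mult[OF G R] assoc_mult_mat_vec[of _ k k _ k] flip: v_def)
    show "alg_eval l \<tau> ?c = 0\<^sub>m l l" if l\<tau>: "(l, \<tau>) \<in> set N" for l \<tau>
    proof -
      have R': "\<tau> \<in> Rep \<Gamma> l" using N[OF l\<tau>] by (simp add: irreducible_rep_def)
      have c: "alg_eval l \<tau> a \<in> carrier_mat l l" "alg_eval l \<tau> b \<in> carrier_mat l l"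
        using alg_eval_carrier[OF R'] a b by auto
      have "alg_eval l \<tau> a = 0\<^sub>m l l"
      proof (rule eq_matI)
        fix i j assume "i < dim_row (0\<^sub>m l l :: complex mat)" "j < dim_col (0\<^sub>m l l :: complex mat)"
        then have ij: "i < l" "j < l" by auto
        have "alg_eval l \<tau> a *\<^sub>v unit_vec l j = 0\<^sub>v l" using kill l\<tau> ij by fastforce
        then have "(alg_eval l \<tau> a *\<^sub>v unit_vec l j) $ i = 0" using ij by simp
        then show "alg_eval l \<tau> a $$ (i, j) = 0\<^sub>m l l $$ (i, j)" using ij c by simp
      qed (use c in auto)
      then show ?thesis using c by (simp add: alg_eval_mult[OF G R' b(1) a])
    qed
  qed (use w in auto)
qed

definition character_sum :: "(nat \<times> ('g \<Rightarrow> complex mat)) list \<Rightarrow> 'g \<Rightarrow> complex" where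
  "character_sum L \<gamma> = (\<Sum>(k, \<sigma>)\<leftarrow>L. mat_trace (\<sigma> \<gamma>))"

lemma sum_mat_trace_alg_eval:
  assumes "\<And>k \<sigma>. (k, \<sigma>) \<in> set L \<Longrightarrow> \<sigma> \<in> Rep \<Gamma> k" and a: "a \<in> group_algebra \<Gamma>"
  shows "(\<Sum>(k, \<sigma>)\<leftarrow>L. mat_trace (alg_eval k \<sigma> a)) = (\<Sum>(c, \<gamma>)\<leftarrow>a. c * character_sum L \<gamma>)"
  using assms(1)
proof (induction L)
  case (Cons x L)
  obtain k \<sigma> where x: "x = (k, \<sigma>)" by (cases x)
  have "mat_trace (alg_eval k \<sigma> a) = (\<Sum>(c, \<gamma>)\<leftarrow>a. c * mat_trace (\<sigma> \<gamma>))"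
    using mat_trace_alg_eval[of \<sigma> \<Gamma> k a] Cons.prems[of k \<sigma>] a by (simp add: x)
  with Cons show ?case
    by (simp add: x character_sum_def distrib_left case_prod_unfold sum_list_addf)
qed (simp add: character_sum_def case_prod_unfold)

lemma mat_trace_equivalent:
  assumes \<sigma>: "\<sigma> \<in> Rep \<Gamma> k" and \<tau>: "\<tau> \<in> Rep \<Gamma> l" and equiv: "equivalent_reps \<Gamma> k \<sigma> l \<tau>"
    and a: "a \<in> group_algebra \<Gamma>"
  shows "mat_trace (alg_eval k \<sigma> a) = mat_trace (alg_eval l \<tau> a)"
proof -
  obtain P where l: "l = k" and P: "P \<in> carrier (GL k)" and I: "intertwiner \<Gamma> k \<sigma> k \<tau> P"
    using equiv by (auto simp: equivalent_reps_def)
  note inv = GL_inv[OF P] and Pc = GL_carrier_mat[OF P]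
  have c: "alg_eval k \<sigma> a \<in> carrier_mat k k" "alg_eval k \<tau> a \<in> carrier_mat k k"
    using alg_eval_carrier[OF \<sigma> a] alg_eval_carrier[OF \<tau> a] by (auto simp: l)
  have "P * alg_eval k \<sigma> a * inv\<^bsub>GL k\<^esub> P = alg_eval k \<tau> a * P * inv\<^bsub>GL k\<^esub> P"
    using intertwiner_alg_eval[OF \<sigma> _ I a] \<tau> by (simp add: l)
  also have "\<dots> = alg_eval k \<tau> a"
    using c Pc inv by (simp add: assoc_mult_mat[of _ k k _ k _ k])
  finally show ?thesis
    using mat_trace_conjugate[OF c(1) Pc inv(1,3)] by (simp add: l)
qed

text \<open>
  An irreducible summand occurring on one side of an equality of characters occurs on the other
  side: an element of the group algebra that acts as zero on all summands inequivalent to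
  \<open>\<sigma>\<close>, and on \<open>\<sigma>\<close> with nonzero trace, would otherwise see the summand on one side
  only.
\<close>

lemma equal_characters_common_summand:
  assumes G: "group \<Gamma>"
    and L1: "\<And>k \<sigma>. (k, \<sigma>) \<in> set L1 \<Longrightarrow> irreducible_rep \<Gamma> k \<sigma>"
    and L2: "\<And>k \<sigma>. (k, \<sigma>) \<in> set L2 \<Longrightarrow> irreducible_rep \<Gamma> k \<sigma>"
    and eq: "\<And>\<gamma>. \<gamma> \<in> carrier \<Gamma> \<Longrightarrow> character_sum L1 \<gamma> = character_sum L2 \<gamma>"
    and \<sigma>: "(k, \<sigma>) \<in> set L1"
  obtains l \<tau> where "(l, \<tau>) \<in> set L2" "equivalent_reps \<Gamma> l \<tau> k \<sigma>"
proof (rule ccontr)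
  assume "\<not> thesis"
  then have none: "\<not> equivalent_reps \<Gamma> l \<tau> k \<sigma>" if "(l, \<tau>) \<in> set L2" for l \<tau>
    using that \<open>\<And>\<tau> l. \<lbrakk>(l, \<tau>) \<in> set L2; equivalent_reps \<Gamma> l \<tau> k \<sigma>\<rbrakk> \<Longrightarrow> thesis\<close> by blast
  let ?eq = "\<lambda>(l, \<tau>). equivalent_reps \<Gamma> l \<tau> k \<sigma>"
  have irr: "irreducible_rep \<Gamma> k \<sigma>" and R: "\<sigma> \<in> Rep \<Gamma> k" using L1[OF \<sigma>] by (auto simp: irreducible_rep_def)
  have N: "irreducible_rep \<Gamma> l \<tau> \<and> \<not> equivalent_reps \<Gamma> l \<tau> k \<sigma>"
    if "(l, \<tau>) \<in> set (filter (\<lambda>x. \<not> ?eq x) (L1 @ L2))" for l \<tau>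
    using that L1 L2 by auto
  obtain a w where a: "a \<in> group_algebra \<Gamma>"
    and kill: "\<And>l \<tau>. (l, \<tau>) \<in> set (filter (\<lambda>x. \<not> ?eq x) (L1 @ L2)) \<Longrightarrow> alg_eval l \<tau> a = 0\<^sub>m l l"
    and w: "w \<in> carrier_vec k" "w \<noteq> 0\<^sub>v k" "alg_eval k \<sigma> a *\<^sub>v w = w"
    using annihilate_inequivalent_reps[OF G irr N] by blast
  obtain m where m: "mat_trace (alg_eval k \<sigma> a ^\<^sub>m Suc m) \<noteq> 0"
    using exists_power_with_nonzero_trace[OF alg_eval_carrier[OF R a] w] by blast
  obtain b where b: "b \<in> group_algebra \<Gamma>"
    and power: "\<And>n \<sigma>. \<sigma> \<in> Rep \<Gamma> n \<Longrightarrow> alg_eval n \<sigma> b = alg_eval n \<sigma> a ^\<^sub>m Suc m"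
    using alg_power[OF G a, of "Suc m"] by blast
  have trace: "mat_trace (alg_eval l \<tau> b) = (if ?eq (l, \<tau>) then mat_trace (alg_eval k \<sigma> b) else 0)"
    if l\<tau>: "(l, \<tau>) \<in> set (L1 @ L2)" for l \<tau>
  proof -
    have R': "\<tau> \<in> Rep \<Gamma> l" using l\<tau> L1 L2 by (auto simp: irreducible_rep_def)
    show ?thesis
    proof (cases "equivalent_reps \<Gamma> l \<tau> k \<sigma>")
      case True
      then show ?thesis using mat_trace_equivalent[OF R' R True b] by simp
    next
      case False
      then have "alg_eval l \<tau> a = 0\<^sub>m l l" using kill l\<tau> by auto
      then have "alg_eval l \<tau> b = 0\<^sub>m l l" by (simp add: power[OF R'] right_mult_zero_mat[of _ l l])
      then show ?thesis using False by simp
    qed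
  qed
  have count: "(\<Sum>(l, \<tau>)\<leftarrow>L. mat_trace (alg_eval l \<tau> b)) =
      of_nat (length (filter ?eq L)) * mat_trace (alg_eval k \<sigma> b)" if "set L \<subseteq> set (L1 @ L2)" for L
    using that
  proof (induction L)
    case (Cons x L)
    then show ?case using trace[of "fst x" "snd x"] by (cases x) (auto simp: distrib_right)
  qed simp
  have "length (filter ?eq L1) \<noteq> 0" 
    using \<sigma> equivalent_reps_refl[OF R] by (auto simp: filter_empty_conv)
  moreover have "length (filter ?eq L2) = 0" using none by (auto simp: filter_empty_conv)
  moreover have "(\<Sum>(l, \<tau>)\<leftarrow>L1. mat_trace (alg_eval l \<tau> b)) = (\<Sum>(l, \<tau>)\<leftarrow>L2. mat_trace (alg_eval l \<tau> b))"
  proof -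
    have "(\<Sum>(c, \<gamma>)\<leftarrow>b. c * character_sum L1 \<gamma>) = (\<Sum>(c, \<gamma>)\<leftarrow>b. c * character_sum L2 \<gamma>)"
      using b eq by (intro arg_cong[of _ _ sum_list] map_cong) (auto simp: group_algebra_def)
    then show ?thesis
      using sum_mat_trace_alg_eval[OF _ b, of L1] sum_mat_trace_alg_eval[OF _ b, of L2] L1 L2
      by (simp add: irreducible_rep_def)
  qed
  ultimately show False using count[of L1] count[of L2] m power[OF R] by simp
qed

section \<open>Direct sums\<close>

definition block_sum :: "'a::zero mat \<Rightarrow> 'a mat \<Rightarrow> 'a mat" where
  "block_sum A B =
     four_block_mat A (0\<^sub>m (dim_row A) (dim_col B)) (0\<^sub>m (dim_row B) (dim_col A)) B"

lemma block_sum_carrier [simp]: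
  "\<lbrakk>A \<in> carrier_mat k k'; B \<in> carrier_mat l l'\<rbrakk> \<Longrightarrow> block_sum A B \<in> carrier_mat (k + l) (k' + l')"
  by (auto simp: block_sum_def)

lemma block_sum_mult:
  fixes A :: "'a::comm_ring_1 mat"
  assumes "A \<in> carrier_mat k k" "A' \<in> carrier_mat k k" "B \<in> carrier_mat l l" "B' \<in> carrier_mat l l"
  shows "block_sum A B * block_sum A' B' = block_sum (A * A') (B * B')"
proof -
  have "block_sum A B * block_sum A' B' =
      four_block_mat A (0\<^sub>m k l) (0\<^sub>m l k) B * four_block_mat A' (0\<^sub>m k l) (0\<^sub>m l k) B'"
    using assms by (simp add: block_sum_def)
  also have "\<dots> = block_sum (A * A') (B * B')"
    using assms by (subst mult_four_block_mat[of _ k k _ l _ l]) (auto simp: block_sum_def)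
  finally show ?thesis .
qed

lemma block_sum_one: "block_sum (1\<^sub>m k) (1\<^sub>m l) = 1\<^sub>m (k + l)"
  by (auto simp: block_sum_def)

lemma block_sum_smult: "c \<cdot>\<^sub>m block_sum A B = block_sum (c \<cdot>\<^sub>m A) (c \<cdot>\<^sub>m (B :: 'a::comm_ring_1 mat))"
  by (intro eq_matI) (auto simp: block_sum_def)

lemma map_mat_block_sum: "f 0 = 0 \<Longrightarrow> map_mat f (block_sum A B) = block_sum (map_mat f A) (map_mat f B)"
  by (intro eq_matI) (auto simp: block_sum_def)

lemma block_sum_assoc: "block_sum A (block_sum B C) = block_sum (block_sum A B) C"
  using assoc_four_block_mat[of A B C] by (simp add: block_sum_def)

lemma diag_block_mat_Cons: "diag_block_mat (A # As) = block_sum A (diag_block_mat As)"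
  by (simp add: block_sum_def Let_def)

lemma diag_block_mat_pair: "diag_block_mat [A, B] = block_sum A B"
  using diag_block_mat_Cons[of A "[B]"] by (simp only: diag_block_mat_singleton)

lemma mat_trace_block_sum:
  fixes A B :: "'a::comm_ring_1 mat"
  assumes "A \<in> carrier_mat k k" "B \<in> carrier_mat l l"
  shows "mat_trace (block_sum A B) = mat_trace A + mat_trace B"
proof -
  have split: "(\<Sum>i<k + m. f i) = (\<Sum>i<k. f i) + (\<Sum>i<m. f (k + i))" for m and f :: "nat \<Rightarrow> 'a"
    by (induction m) (simp_all add: add.assoc)
  have "mat_trace (block_sum A B) = (\<Sum>i<k + l. block_sum A B $$ (i, i))"
    using assms by (simp add: mat_trace_def block_sum_def)
  also have "\<dots> = (\<Sum>i<k. block_sum A B $$ (i, i)) + (\<Sum>i<l. block_sum A B $$ (k + i, k + i))"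
    by (rule split)
  also have "\<dots> = mat_trace A + mat_trace B"
    using assms by (simp add: mat_trace_def block_sum_def)
  finally show ?thesis .
qed

definition rep_sum :: "('g \<Rightarrow> complex mat) \<Rightarrow> ('g \<Rightarrow> complex mat) \<Rightarrow> 'g \<Rightarrow> complex mat" where
  "rep_sum \<sigma> \<tau> = (\<lambda>\<gamma>. block_sum (\<sigma> \<gamma>) (\<tau> \<gamma>))"

lemma rep_sum_Rep:
  assumes G: "group \<Gamma>" and \<sigma>: "\<sigma> \<in> Rep \<Gamma> k" and \<tau>: "\<tau> \<in> Rep \<Gamma> l"
  shows "rep_sum \<sigma> \<tau> \<in> Rep \<Gamma> (k + l)"
  by (rule Rep_I[OF G])
    (auto simp: rep_sum_def Rep_carrier[OF \<sigma>] Rep_carrier[OF \<tau>] Rep_mult[OF \<sigma>] Rep_mult[OF \<tau>]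
      Rep_one[OF G \<sigma>] Rep_one[OF G \<tau>] block_sum_one block_sum_mult[of _ k _ _ l])

lemma rep_sum_assoc: "rep_sum \<sigma> (rep_sum \<tau> \<mu>) = rep_sum (rep_sum \<sigma> \<tau>) \<mu>"
  by (simp add: rep_sum_def block_sum_assoc)

lemma rep_sum_equivalent:
  assumes \<sigma>: "\<sigma> \<in> Rep \<Gamma> k" "\<sigma>' \<in> Rep \<Gamma> k'" "equivalent_reps \<Gamma> k \<sigma> k' \<sigma>'"
    and \<tau>: "\<tau> \<in> Rep \<Gamma> l" "\<tau>' \<in> Rep \<Gamma> l'" "equivalent_reps \<Gamma> l \<tau> l' \<tau>'"
  shows "equivalent_reps \<Gamma> (k + l) (rep_sum \<sigma> \<tau>) (k' + l') (rep_sum \<sigma>' \<tau>')"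
proof -
  obtain P Q where k: "k' = k" and P: "P \<in> carrier_mat k k" "Q \<in> carrier_mat k k" "P * Q = 1\<^sub>m k"
    and P_comm: "\<And>\<gamma>. \<gamma> \<in> carrier \<Gamma> \<Longrightarrow> \<sigma>' \<gamma> * P = P * \<sigma> \<gamma>"
    using equivalent_repsE[OF \<sigma>(3)] by metis
  obtain P' Q' where l: "l' = l" and P': "P' \<in> carrier_mat l l" "Q' \<in> carrier_mat l l" "P' * Q' = 1\<^sub>m l"
    and P'_comm: "\<And>\<gamma>. \<gamma> \<in> carrier \<Gamma> \<Longrightarrow> \<tau>' \<gamma> * P' = P' * \<tau> \<gamma>"
    using equivalent_repsE[OF \<tau>(3)] by metis
  have "equivalent_reps \<Gamma> (k + l) (rep_sum \<sigma> \<tau>) (k + l) (rep_sum \<sigma>' \<tau>')"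
  proof (rule equivalent_repsI[of "block_sum P P'" _ "block_sum Q Q'"])
    show "block_sum P P' * block_sum Q Q' = 1\<^sub>m (k + l)"
      using P P' by (simp add: block_sum_mult[of _ k _ _ l] block_sum_one)
    fix \<gamma> assume \<gamma>: "\<gamma> \<in> carrier \<Gamma>"
    show "rep_sum \<sigma>' \<tau>' \<gamma> * block_sum P P' = block_sum P P' * rep_sum \<sigma> \<tau> \<gamma>"
      using P P' P_comm[OF \<gamma>] P'_comm[OF \<gamma>] Rep_carrier[OF \<sigma>(1) \<gamma>] Rep_carrier[OF \<sigma>(2) \<gamma>]
        Rep_carrier[OF \<tau>(1) \<gamma>] Rep_carrier[OF \<tau>(2) \<gamma>]
      by (simp add: rep_sum_def block_sum_mult[of _ k _ _ l] k l)
  qed (use P P' in auto)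
  then show ?thesis by (simp add: k l)
qed

definition swap_mat :: "nat \<Rightarrow> nat \<Rightarrow> complex mat" where
  "swap_mat k l = four_block_mat (0\<^sub>m l k) (1\<^sub>m l) (1\<^sub>m k) (0\<^sub>m k l)"

lemma swap_mat_carrier: "swap_mat k l \<in> carrier_mat (l + k) (k + l)"
  by (simp add: swap_mat_def)

lemma swap_mat_inverse: "swap_mat k l * swap_mat l k = 1\<^sub>m (l + k)"
  unfolding swap_mat_def by (subst mult_four_block_mat[of _ l k _ l _ k]) auto

lemma swap_mat_block_sum:
  assumes A: "A \<in> carrier_mat k k" and B: "B \<in> carrier_mat l l"
  shows "block_sum B A * swap_mat k l = swap_mat k l * block_sum A B"
proof -
  have "block_sum B A * swap_mat k l = four_block_mat (0\<^sub>m l k) B A (0\<^sub>m k l)"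
    using assms unfolding swap_mat_def block_sum_def
    by (subst mult_four_block_mat[of _ l l _ k _ k _ _ k _ l]) auto
  moreover have "swap_mat k l * block_sum A B = four_block_mat (0\<^sub>m l k) B A (0\<^sub>m k l)"
    using assms unfolding swap_mat_def block_sum_def
    by (subst mult_four_block_mat[of _ l k _ l _ k _ _ k _ l]) auto
  ultimately show ?thesis by simp
qed

lemma rep_sum_comm:
  assumes \<sigma>: "\<sigma> \<in> Rep \<Gamma> k" and \<tau>: "\<tau> \<in> Rep \<Gamma> l"
  shows "equivalent_reps \<Gamma> (k + l) (rep_sum \<sigma> \<tau>) (l + k) (rep_sum \<tau> \<sigma>)"
proof -
  have "equivalent_reps \<Gamma> (k + l) (rep_sum \<sigma> \<tau>) (k + l) (rep_sum \<tau> \<sigma>)"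
  proof (rule equivalent_repsI[of "swap_mat k l" _ "swap_mat l k"])
    fix \<gamma> assume \<gamma>: "\<gamma> \<in> carrier \<Gamma>"
    show "rep_sum \<tau> \<sigma> \<gamma> * swap_mat k l = swap_mat k l * rep_sum \<sigma> \<tau> \<gamma>"
      using swap_mat_block_sum[OF Rep_carrier[OF \<sigma> \<gamma>] Rep_carrier[OF \<tau> \<gamma>]] by (simp add: rep_sum_def)
  qed (use swap_mat_carrier[of k l] swap_mat_carrier[of l k] swap_mat_inverse[of k l]
      in \<open>simp_all add: add.commute\<close>)
  then show ?thesis by (simp add: add.commute)
qed

definition list_rep :: "(nat \<times> ('g \<Rightarrow> complex mat)) list \<Rightarrow> 'g \<Rightarrow> complex mat" where
  "list_rep L = (\<lambda>\<gamma>. diag_block_mat (map (\<lambda>(k, \<sigma>). \<sigma> \<gamma>) L))"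

abbreviation list_dim :: "(nat \<times> ('g \<Rightarrow> complex mat)) list \<Rightarrow> nat" where
  "list_dim L \<equiv> sum_list (map fst L)"

lemma list_rep_Cons: "list_rep ((k, \<sigma>) # L) = rep_sum \<sigma> (list_rep L)"
  by (simp only: list_rep_def rep_sum_def list.map prod.case diag_block_mat_Cons)

lemma zero_dim_Rep:
  assumes "group \<Gamma>"
  shows "(\<lambda>_. 0\<^sub>m 0 0) \<in> Rep \<Gamma> 0"
  by (rule Rep_I[OF assms]) (auto intro: eq_matI)

lemma list_rep_Rep:
  assumes G: "group \<Gamma>" and "\<And>k \<sigma>. (k, \<sigma>) \<in> set L \<Longrightarrow> \<sigma> \<in> Rep \<Gamma> k"
  shows "list_rep L \<in> Rep \<Gamma> (list_dim L)"
  using assms(2)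
proof (induction L)
  case Nil
  then show ?case using zero_dim_Rep[OF G] by (simp add: list_rep_def)
next
  case (Cons x L)
  obtain k \<sigma> where x: "x = (k, \<sigma>)" by (cases x)
  show ?case
    using rep_sum_Rep[OF G, of \<sigma> k "list_rep L" "list_dim L"] Cons by (simp add: x list_rep_Cons)
qed

lemma mat_trace_list_rep:
  assumes G: "group \<Gamma>" and "\<And>k \<sigma>. (k, \<sigma>) \<in> set L \<Longrightarrow> \<sigma> \<in> Rep \<Gamma> k" and \<gamma>: "\<gamma> \<in> carrier \<Gamma>"
  shows "mat_trace (list_rep L \<gamma>) = character_sum L \<gamma>"
  using assms(2)
proof (induction L)
  case Nil
  then show ?case by (simp add: list_rep_def character_sum_def)
next
  case (Cons x L)
  obtain k \<sigma> where x: "x = (k, \<sigma>)" by (cases x)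
  have R: "list_rep L \<in> Rep \<Gamma> (list_dim L)" "\<sigma> \<in> Rep \<Gamma> k"
    using list_rep_Rep[OF G, of L] Cons.prems by (auto simp: x)
  show ?case
    using Cons Rep_carrier[OF R(1) \<gamma>] Rep_carrier[OF R(2) \<gamma>]
    by (simp add: x list_rep_Cons rep_sum_def character_sum_def mat_trace_block_sum[of _ k _ "list_dim L"])
qed

lemma list_rep_move_to_front:
  assumes G: "group \<Gamma>" and R: "\<And>k \<sigma>. (k, \<sigma>) \<in> set (A @ x # B) \<Longrightarrow> \<sigma> \<in> Rep \<Gamma> k"
  shows "equivalent_reps \<Gamma> (list_dim (A @ x # B)) (list_rep (A @ x # B))
    (list_dim (x # A @ B)) (list_rep (x # A @ B))"
  using R
proof (induction A)
  case Nil
  then show ?case using equivalent_reps_refl[OF list_rep_Rep[OF G, of "x # B"]] by simp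
next
  case (Cons y A)
  obtain k \<sigma> where x: "x = (k, \<sigma>)" by (cases x)
  obtain l \<tau> where y: "y = (l, \<tau>)" by (cases y)
  have R: "\<sigma> \<in> Rep \<Gamma> k" "\<tau> \<in> Rep \<Gamma> l" using Cons.prems by (auto simp: x y)
  let ?m = "list_dim (A @ B)" and ?\<mu> = "list_rep (A @ B)"
  have \<mu>: "?\<mu> \<in> Rep \<Gamma> ?m" using list_rep_Rep[OF G, of "A @ B"] Cons.prems by auto
  have A: "list_rep (A @ x # B) \<in> Rep \<Gamma> (list_dim (A @ x # B))"
    using list_rep_Rep[OF G, of "A @ x # B"] Cons.prems by auto
  have \<sigma>\<mu>: "rep_sum \<sigma> ?\<mu> \<in> Rep \<Gamma> (k + ?m)" and \<tau>\<sigma>: "rep_sum \<tau> \<sigma> \<in> Rep \<Gamma> (l + k)"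
    and \<sigma>\<tau>: "rep_sum \<sigma> \<tau> \<in> Rep \<Gamma> (k + l)" using rep_sum_Rep[OF G] R \<mu> by auto
  have 1: "equivalent_reps \<Gamma> (l + list_dim (A @ x # B)) (rep_sum \<tau> (list_rep (A @ x # B)))
      (l + (k + ?m)) (rep_sum \<tau> (rep_sum \<sigma> ?\<mu>))"
    using Cons.IH Cons.prems
    by (intro rep_sum_equivalent R A \<sigma>\<mu> equivalent_reps_refl) (auto simp: x list_rep_Cons)
  have 2: "equivalent_reps \<Gamma> (l + k + ?m) (rep_sum (rep_sum \<tau> \<sigma>) ?\<mu>)
      (k + l + ?m) (rep_sum (rep_sum \<sigma> \<tau>) ?\<mu>)"
    by (intro rep_sum_equivalent rep_sum_comm R \<tau>\<sigma> \<sigma>\<tau> \<mu> equivalent_reps_refl)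
  have "equivalent_reps \<Gamma> (l + list_dim (A @ x # B)) (rep_sum \<tau> (list_rep (A @ x # B)))
      (k + l + ?m) (rep_sum (rep_sum \<sigma> \<tau>) ?\<mu>)"
    using equivalent_reps_trans[OF rep_sum_Rep[OF G R(2) A] rep_sum_Rep[OF G R(2) \<sigma>\<mu>]
        rep_sum_Rep[OF G \<sigma>\<tau> \<mu>] 1] 2 by (simp add: rep_sum_assoc add.assoc)
  then show ?case by (simp add: x y list_rep_Cons rep_sum_assoc add.assoc)
qed

section \<open>Real and quaternionic structures\<close>

text \<open>
  With \<open>T v = P (cnj v)\<close>, the condition says that the antilinear map \<open>T\<close> commutes with the
  representation and has square \<open>\<epsilon>\<close>.  It is a real structure for \<open>\<epsilon> = 1\<close> and a quaternionic
  structure for \<open>\<epsilon> = -1\<close>.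
\<close>

definition conj_structure :: "complex \<Rightarrow> ('g, 'b) monoid_scheme \<Rightarrow> nat \<Rightarrow> ('g \<Rightarrow> complex mat) \<Rightarrow> bool" where
  "conj_structure \<epsilon> \<Gamma> n \<sigma> \<longleftrightarrow>
     (\<exists>P. P * map_mat cnj P = \<epsilon> \<cdot>\<^sub>m 1\<^sub>m n \<and> intertwiner \<Gamma> n (cnj_rep \<sigma>) n \<sigma> P)"

lemma map_mat_cnj_cnj [simp]: "map_mat cnj (map_mat cnj A) = A"
  by (intro eq_matI) auto

lemma map_mat_cnj_one [simp]: "map_mat cnj (1\<^sub>m n) = 1\<^sub>m n"
  by (intro eq_matI) auto

lemma map_mat_cnj_smult: "map_mat cnj (c \<cdot>\<^sub>m A) = cnj c \<cdot>\<^sub>m map_mat cnj A"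
  by (intro eq_matI) auto

lemma map_mat_cnj_add:
  "\<lbrakk>A \<in> carrier_mat n m; B \<in> carrier_mat n m\<rbrakk> \<Longrightarrow> map_mat cnj (A + B) = map_mat cnj A + map_mat cnj B"
  by (intro eq_matI) auto

lemma det_map_mat_cnj: "det (map_mat cnj A) = cnj (det A)"
proof -
  interpret comm_ring_hom cnj by unfold_locales auto
  show ?thesis by (rule hom_det)
qed

lemma GL_det:
  fixes A :: "'a::field mat"
  assumes "A \<in> carrier_mat n n" "det A \<noteq> 0"
  shows "A \<in> carrier (GL n)"
  using det_non_zero_imp_unit[OF assms, of "()"] by (simp add: GL_def units_of_def)

lemma conj_structure_rep_sum:
  assumes \<sigma>: "\<sigma> \<in> Rep \<Gamma> k" "conj_structure \<epsilon> \<Gamma> k \<sigma>" and \<tau>: "\<tau> \<in> Rep \<Gamma> l" "conj_structure \<epsilon> \<Gamma> l \<tau>"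
  shows "conj_structure \<epsilon> \<Gamma> (k + l) (rep_sum \<sigma> \<tau>)"
proof -
  obtain P where P: "P \<in> carrier_mat k k" "P * map_mat cnj P = \<epsilon> \<cdot>\<^sub>m 1\<^sub>m k"
    and P_comm: "\<And>\<gamma>. \<gamma> \<in> carrier \<Gamma> \<Longrightarrow> \<sigma> \<gamma> * P = P * cnj_rep \<sigma> \<gamma>"
    using \<sigma>(2) by (auto simp: conj_structure_def intertwiner_def)
  obtain Q where Q: "Q \<in> carrier_mat l l" "Q * map_mat cnj Q = \<epsilon> \<cdot>\<^sub>m 1\<^sub>m l"
    and Q_comm: "\<And>\<gamma>. \<gamma> \<in> carrier \<Gamma> \<Longrightarrow> \<tau> \<gamma> * Q = Q * cnj_rep \<tau> \<gamma>"
    using \<tau>(2) by (auto simp: conj_structure_def intertwiner_def)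
  have "rep_sum \<sigma> \<tau> \<gamma> * block_sum P Q = block_sum P Q * cnj_rep (rep_sum \<sigma> \<tau>) \<gamma>"
    if \<gamma>: "\<gamma> \<in> carrier \<Gamma>" for \<gamma>
  proof -
    have c: "\<sigma> \<gamma> \<in> carrier_mat k k" "\<tau> \<gamma> \<in> carrier_mat l l"
      using Rep_carrier[OF \<sigma>(1) \<gamma>] Rep_carrier[OF \<tau>(1) \<gamma>] .
    then show ?thesis
      using P Q P_comm[OF \<gamma>] Q_comm[OF \<gamma>]
      by (simp add: rep_sum_def cnj_rep_def map_mat_block_sum block_sum_mult[of _ k _ _ l])
  qed
  moreover have "block_sum P Q * map_mat cnj (block_sum P Q) = \<epsilon> \<cdot>\<^sub>m 1\<^sub>m (k + l)"
    using P Q by (simp add: map_mat_block_sum block_sum_mult[of _ k _ _ l]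
        flip: block_sum_one block_sum_smult)
  ultimately show ?thesis using P Q by (auto simp: conj_structure_def intertwiner_def)
qed

text \<open>
  The structure is conjugation followed by the exchange of the two summands.  It deals with the
  irreducible representations that are not equivalent to their conjugates: these occur in pairs.
\<close>

lemma conj_structure_sum_cnj:
  assumes \<sigma>: "\<sigma> \<in> Rep \<Gamma> k"
  shows "conj_structure 1 \<Gamma> (k + k) (rep_sum \<sigma> (cnj_rep \<sigma>))"
  unfolding conj_structure_def intertwiner_def
proof (intro exI conjI ballI)
  have "map_mat cnj (swap_mat k k) = swap_mat k k"
    by (intro eq_matI) (auto simp: swap_mat_def)
  then show "swap_mat k k * map_mat cnj (swap_mat k k) = 1 \<cdot>\<^sub>m 1\<^sub>m (k + k)"
    by (simp add: swap_mat_inverse one_smult_mat)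
  show "swap_mat k k \<in> carrier_mat (k + k) (k + k)" by (rule swap_mat_carrier)
  fix \<gamma> assume "\<gamma> \<in> carrier \<Gamma>"
  then have c: "\<sigma> \<gamma> \<in> carrier_mat k k" using Rep_carrier[OF \<sigma>] by simp
  then show "rep_sum \<sigma> (cnj_rep \<sigma>) \<gamma> * swap_mat k k =
      swap_mat k k * cnj_rep (rep_sum \<sigma> (cnj_rep \<sigma>)) \<gamma>"
    using swap_mat_block_sum[of "map_mat cnj (\<sigma> \<gamma>)" k "\<sigma> \<gamma>" k]
    by (simp add: rep_sum_def cnj_rep_def map_mat_block_sum)
qed

text \<open>
  The square of an equivariant antilinear bijection of an irreducible representation is a
  nonzero scalar by Schur's lemma.  This scalar turns out to be real, and the map can be rescaled by
  a positive number until only the sign of the scalar remains.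
\<close>

lemma irreducible_conj_structure:
  assumes \<sigma>: "irreducible_rep \<Gamma> k \<sigma>" and equiv: "equivalent_reps \<Gamma> k (cnj_rep \<sigma>) k \<sigma>"
  shows "conj_structure 1 \<Gamma> k \<sigma> \<or> conj_structure (-1) \<Gamma> k \<sigma>"
proof -
  have k: "0 < k" and R: "\<sigma> \<in> Rep \<Gamma> k" using \<sigma> by (auto simp: irreducible_rep_def)
  obtain P Q where P: "P \<in> carrier_mat k k" and Q: "Q \<in> carrier_mat k k" "P * Q = 1\<^sub>m k" "Q * P = 1\<^sub>m k"
    and comm: "\<And>\<gamma>. \<gamma> \<in> carrier \<Gamma> \<Longrightarrow> \<sigma> \<gamma> * P = P * map_mat cnj (\<sigma> \<gamma>)"
    using equivalent_repsE[OF equiv] by (metis cnj_rep_def)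
  let ?P = "map_mat cnj P"
  have P': "?P \<in> carrier_mat k k" using P by simp
  have "intertwiner \<Gamma> k \<sigma> k \<sigma> (P * ?P)"
    unfolding intertwiner_def
  proof (intro conjI ballI)
    fix \<gamma> assume \<gamma>: "\<gamma> \<in> carrier \<Gamma>"
    have c: "\<sigma> \<gamma> \<in> carrier_mat k k" "map_mat cnj (\<sigma> \<gamma>) \<in> carrier_mat k k"
      using Rep_carrier[OF R \<gamma>] by auto
    have "map_mat cnj (\<sigma> \<gamma> * P) = map_mat cnj (P * map_mat cnj (\<sigma> \<gamma>))" using comm[OF \<gamma>] by simp
    then have "map_mat cnj (\<sigma> \<gamma>) * ?P = ?P * \<sigma> \<gamma>"
      using map_mat_cnj_mult[OF c(1) P] map_mat_cnj_mult[OF P c(2)] by simp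
    then show "\<sigma> \<gamma> * (P * ?P) = P * ?P * \<sigma> \<gamma>"
      using comm[OF \<gamma>] assoc_mult_mat[OF c(1) P P'] assoc_mult_mat[OF P c(2) P'] assoc_mult_mat[OF P P' c(1)]
      by simp
  qed (use P in simp)
  then obtain c where c: "P * ?P = c \<cdot>\<^sub>m 1\<^sub>m k" using schur_scalar[OF \<sigma>] by blast
  \<comment> \<open>\<open>P * ?P\<close> and \<open>?P * P\<close> are complex conjugates of each other and have the same trace.\<close>
  have "?P * P = map_mat cnj (P * ?P)" using map_mat_cnj_mult[OF P P'] by simp
  then have "c * of_nat k = cnj c * of_nat k"
    using mat_trace_comm[OF P P'] c by (simp add: map_mat_cnj_smult mat_trace_smult[of _ k])
  then have "cnj c = c" using k by simp
  then obtain r where r: "c = of_real r" by (metis Reals_cnj_iff Reals_cases)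
  have "r \<noteq> 0"
  proof
    assume "r = 0"
    then have "P * ?P = 0\<^sub>m k k" using c r by (auto intro!: eq_matI)
    then have "?P = 0\<^sub>m k k" using assoc_mult_mat[OF Q(1) P P'] Q P' by simp
    then have "map_mat cnj ?P = map_mat cnj (0\<^sub>m k k)" by simp
    then have "P = 0\<^sub>m k k" unfolding map_mat_cnj_cnj by (auto intro!: eq_matI)
    then have "1\<^sub>m k = (0\<^sub>m k k :: complex mat)" using Q by simp
    then have "(1\<^sub>m k :: complex mat) $$ (0, 0) = 0\<^sub>m k k $$ (0, 0)" by simp
    then show False using k by simp
  qed
  define s where "s = complex_of_real (1 / sqrt \<bar>r\<bar>)"
  have s: "cnj s = s" "s * s * c = complex_of_real (sgn r)"
  proof -
    have "1 / sqrt \<bar>r\<bar> * (1 / sqrt \<bar>r\<bar>) * r = sgn r"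
      using \<open>r \<noteq> 0\<close> by (simp add: sgn_if)
    then show "s * s * c = complex_of_real (sgn r)" unfolding s_def r by (metis of_real_mult)
  qed (simp add: s_def)
  have "(s \<cdot>\<^sub>m P) * map_mat cnj (s \<cdot>\<^sub>m P) = complex_of_real (sgn r) \<cdot>\<^sub>m 1\<^sub>m k"
    using P P' c s by (simp add: map_mat_cnj_smult mult_smult_assoc_mat[of _ k k _ k]
        mult_smult_distrib[of _ k k _ k] smult_smult_mat mult.assoc)
  moreover have "intertwiner \<Gamma> k (cnj_rep \<sigma>) k \<sigma> (s \<cdot>\<^sub>m P)"
    unfolding intertwiner_def
  proof (intro conjI ballI)
    fix \<gamma> assume \<gamma>: "\<gamma> \<in> carrier \<Gamma>"
    show "\<sigma> \<gamma> * (s \<cdot>\<^sub>m P) = s \<cdot>\<^sub>m P * cnj_rep \<sigma> \<gamma>"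
      using comm[OF \<gamma>] P Rep_carrier[OF R \<gamma>]
      by (simp add: cnj_rep_def mult_smult_assoc_mat[of _ k k _ k] mult_smult_distrib[of _ k k _ k])
  qed (use P in simp)
  ultimately have "conj_structure (complex_of_real (sgn r)) \<Gamma> k \<sigma>" by (auto simp: conj_structure_def)
  then show ?thesis using \<open>r \<noteq> 0\<close> by (auto simp: sgn_if split: if_splits)
qed

text \<open>
  A version of Hilbert's Theorem 90 for the general linear group.  The matrices
  \<open>cnj t \<cdot> P + t \<cdot> K\<close> solve the equation for every complex \<open>t\<close>, and since \<open>P * K\<close> has only finitely
  many eigenvalues some \<open>t\<close> gives an invertible one.
\<close>

lemma hilbert90:
  fixes P K :: "complex mat"
  assumes P: "P \<in> carrier_mat n n" and K: "K \<in> carrier_mat n n" "map_mat cnj K = K"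
    and square: "P * map_mat cnj P = \<epsilon> \<cdot>\<^sub>m 1\<^sub>m n" "K * K = \<epsilon> \<cdot>\<^sub>m 1\<^sub>m n" and \<epsilon>: "\<epsilon> \<noteq> 0"
  obtains Q where "Q \<in> carrier (GL n)" "P * map_mat cnj Q = Q * K"
proof -
  have PK: "P * K \<in> carrier_mat n n" using P K by simp
  \<comment> \<open>The value \<open>e x\<close> is chosen such that \<open>Q * K\<close> below is a multiple of \<open>P * K - e x\<close>.\<close>
  define t where "t x = Complex 1 x" for x
  define e where "e x = - (\<epsilon> * t x / cnj (t x))" for x
  have t: "t x \<noteq> 0" "cnj (t x) \<noteq> 0" for x by (auto simp: t_def complex_eq_iff)
  have "inj e"
  proof (rule injI)
    fix x y assume "e x = e y"
    then have "t x * cnj (t y) = t y * cnj (t x)" using t \<epsilon> by (simp add: e_def field_simps)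
    then show "x = y" by (simp add: t_def complex_eq_iff)
  qed
  then have "infinite (range e)" using infinite_UNIV_char_0 finite_imageD by blast
  then have "\<not> range e \<subseteq> spectrum (P * K)"
    using card_finite_spectrum(1)[OF PK] finite_subset by blast
  then obtain x where x: "\<not> eigenvalue (P * K) (e x)" by (auto simp: spectrum_def)
  define Q where "Q = cnj (t x) \<cdot>\<^sub>m P + t x \<cdot>\<^sub>m K"
  have Q: "Q \<in> carrier_mat n n" using P K by (simp add: Q_def)
  have QK: "Q * K = cnj (t x) \<cdot>\<^sub>m (P * K) + (t x * \<epsilon>) \<cdot>\<^sub>m 1\<^sub>m n"
    using P K square by (simp add: Q_def add_mult_distrib_mat[of _ n n _ _ n]
        mult_smult_assoc_mat[of _ n n _ n] smult_smult_mat)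
  have P': "map_mat cnj P \<in> carrier_mat n n" using P by simp
  have "map_mat cnj Q = t x \<cdot>\<^sub>m map_mat cnj P + cnj (t x) \<cdot>\<^sub>m K"
    using P K by (simp add: Q_def map_mat_cnj_add[of _ n n] map_mat_cnj_smult)
  then have "P * map_mat cnj Q = (t x * \<epsilon>) \<cdot>\<^sub>m 1\<^sub>m n + cnj (t x) \<cdot>\<^sub>m (P * K)"
    using P P' K square by (simp add: mult_add_distrib_mat[of _ n n _ n]
        mult_smult_distrib[of _ n n _ n] smult_smult_mat)
  then have solves: "P * map_mat cnj Q = Q * K"
    unfolding QK using PK by (simp add: comm_add_mat[of _ n n])
  have "Q * K = cnj (t x) \<cdot>\<^sub>m char_matrix (P * K) (e x)"
    unfolding QK using P K t
    by (intro eq_matI) (auto simp: char_matrix_def e_def field_simps)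
  moreover have "det (char_matrix (P * K) (e x)) \<noteq> 0" using x eigenvalue_det[OF PK] by simp
  ultimately have "det (Q * K) \<noteq> 0" using t PK by (simp add: det_smult)
  then have "det Q \<noteq> 0" using det_mult[OF Q K(1)] by simp
  then show ?thesis using that[OF GL_det[OF Q]] solves by blast
qed

text \<open>
  In the basis given by the columns of the matrix \<open>Q\<close> of the preceding lemma, the antilinear map
  \<open>P (cnj v)\<close> becomes \<open>K (cnj v)\<close>.  For \<open>K = 1\<close>, commuting with this map means having real entries;
  for \<open>K = J\<close> it is the equation that defines the quaternionic linear group.
\<close>

lemma conj_structure_normal_form:
  assumes G: "group \<Gamma>" and \<sigma>: "\<sigma> \<in> Rep \<Gamma> n" "conj_structure \<epsilon> \<Gamma> n \<sigma>"
    and K: "K \<in> carrier_mat n n" "map_mat cnj K = K" "K * K = \<epsilon> \<cdot>\<^sub>m 1\<^sub>m n" and \<epsilon>: "\<epsilon> \<noteq> 0"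
  obtains \<tau> where "\<tau> \<in> Rep \<Gamma> n" "equivalent_reps \<Gamma> n \<sigma> n \<tau>"
    "\<And>\<gamma>. \<gamma> \<in> carrier \<Gamma> \<Longrightarrow> \<tau> \<gamma> * K = K * map_mat cnj (\<tau> \<gamma>)"
proof -
  obtain P where P: "P \<in> carrier_mat n n" "P * map_mat cnj P = \<epsilon> \<cdot>\<^sub>m 1\<^sub>m n"
    and comm: "\<And>\<gamma>. \<gamma> \<in> carrier \<Gamma> \<Longrightarrow> \<sigma> \<gamma> * P = P * map_mat cnj (\<sigma> \<gamma>)"
    using \<sigma>(2) by (auto simp: conj_structure_def intertwiner_def cnj_rep_def)
  obtain Q where Q: "Q \<in> carrier (GL n)" "P * map_mat cnj Q = Q * K"
    using hilbert90[OF P(1) K(1,2) P(2) K(3) \<epsilon>] by blast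
  note Qc = GL_carrier_mat[OF Q(1)] and R = GL_inv[OF Q(1)]
  let ?R = "inv\<^bsub>GL n\<^esub> Q" and ?Q = "map_mat cnj Q"
  define \<tau> where "\<tau> = (\<lambda>\<gamma>. ?R * \<sigma> \<gamma> * Q)"
  have Q': "?Q \<in> carrier_mat n n" using Qc by simp
  have \<sigma>c: "\<sigma> \<gamma> \<in> carrier_mat n n" if "\<gamma> \<in> carrier \<Gamma>" for \<gamma> using Rep_carrier[OF \<sigma>(1) that] .
  have \<tau>c: "\<tau> \<gamma> \<in> carrier_mat n n" if "\<gamma> \<in> carrier \<Gamma>" for \<gamma>
    using \<sigma>c[OF that] Qc R by (simp add: \<tau>_def)
  have Q\<tau>: "Q * \<tau> \<gamma> = \<sigma> \<gamma> * Q" if "\<gamma> \<in> carrier \<Gamma>" for \<gamma>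
  proof -
    have "Q * \<tau> \<gamma> = Q * ?R * (\<sigma> \<gamma> * Q)"
      using \<sigma>c[OF that] Qc R(1) by (simp add: \<tau>_def assoc_mult_mat[of _ n n _ n _ n])
    then show ?thesis using \<sigma>c[OF that] Qc R by simp
  qed
  have cancel: "A = B" if "Q * A = Q * B" "A \<in> carrier_mat n n" "B \<in> carrier_mat n n" for A B
  proof -
    have "?R * (Q * A) = ?R * (Q * B)" using that(1) by simp
    then show ?thesis
      using assoc_mult_mat[OF R(1) Qc that(2)] assoc_mult_mat[OF R(1) Qc that(3)] R(3) that by simp
  qed
  show ?thesis
  proof (rule that)
    show "\<tau> \<in> Rep \<Gamma> n"
    proof (rule Rep_I[OF G])
      interpret group \<Gamma> by fact
      fix \<gamma> \<delta> assume \<gamma>: "\<gamma> \<in> carrier \<Gamma>" and \<delta>: "\<delta> \<in> carrier \<Gamma>"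
      have "Q * \<tau> (\<gamma> \<otimes>\<^bsub>\<Gamma>\<^esub> \<delta>) = \<sigma> \<gamma> * (\<sigma> \<delta> * Q)"
        using Q\<tau>[of "\<gamma> \<otimes>\<^bsub>\<Gamma>\<^esub> \<delta>"] Rep_mult[OF \<sigma>(1) \<gamma> \<delta>] \<gamma> \<delta> assoc_mult_mat[OF \<sigma>c[OF \<gamma>] \<sigma>c[OF \<delta>] Qc] by simp
      also have "\<dots> = Q * (\<tau> \<gamma> * \<tau> \<delta>)"
        using Q\<tau>[OF \<gamma>] Q\<tau>[OF \<delta>] assoc_mult_mat[OF \<sigma>c[OF \<gamma>] Qc \<tau>c[OF \<delta>]]
          assoc_mult_mat[OF Qc \<tau>c[OF \<gamma>] \<tau>c[OF \<delta>]] by simp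
      finally show "\<tau> (\<gamma> \<otimes>\<^bsub>\<Gamma>\<^esub> \<delta>) = \<tau> \<gamma> * \<tau> \<delta>" 
        by (rule cancel) (use \<gamma> \<delta> \<tau>c[of "\<gamma> \<otimes>\<^bsub>\<Gamma>\<^esub> \<delta>"] \<tau>c[of \<gamma>] \<tau>c[of \<delta>] in auto)
    next
      show "\<tau> \<one>\<^bsub>\<Gamma>\<^esub> = 1\<^sub>m n" using Rep_one[OF G \<sigma>(1)] R Qc by (simp add: \<tau>_def)
    qed (rule \<tau>c)
    show "equivalent_reps \<Gamma> n \<sigma> n \<tau>"
    proof (rule equivalent_repsI[OF R(1) Qc R(3)])
      fix \<gamma> assume \<gamma>: "\<gamma> \<in> carrier \<Gamma>"
      show "\<tau> \<gamma> * ?R = ?R * \<sigma> \<gamma>"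
        using \<sigma>c[OF \<gamma>] Qc R by (simp add: \<tau>_def assoc_mult_mat[of _ n n _ n _ n])
    qed
    fix \<gamma> assume \<gamma>: "\<gamma> \<in> carrier \<Gamma>"
    let ?\<sigma> = "map_mat cnj (\<sigma> \<gamma>)" and ?\<tau> = "map_mat cnj (\<tau> \<gamma>)"
    have c: "?\<sigma> \<in> carrier_mat n n" "?\<tau> \<in> carrier_mat n n" using \<sigma>c[OF \<gamma>] \<tau>c[OF \<gamma>] by auto
    have conj: "?Q * ?\<tau> = ?\<sigma> * ?Q"
      using arg_cong[OF Q\<tau>[OF \<gamma>], of "map_mat cnj"] map_mat_cnj_mult[OF Qc \<tau>c[OF \<gamma>]]
        map_mat_cnj_mult[OF \<sigma>c[OF \<gamma>] Qc] by simp
    have "Q * (\<tau> \<gamma> * K) = \<sigma> \<gamma> * (P * ?Q)"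
      using Q\<tau>[OF \<gamma>] Q(2) assoc_mult_mat[OF Qc \<tau>c[OF \<gamma>] K(1)] assoc_mult_mat[OF \<sigma>c[OF \<gamma>] Qc K(1)] by simp
    also have "\<dots> = P * (?\<sigma> * ?Q)"
      using comm[OF \<gamma>] assoc_mult_mat[OF \<sigma>c[OF \<gamma>] P(1) Q'] assoc_mult_mat[OF P(1) c(1) Q'] by simp
    also have "\<dots> = Q * (K * ?\<tau>)"
      using conj Q(2) assoc_mult_mat[OF P(1) Q' c(2)] assoc_mult_mat[OF Qc K(1) c(2)] by simp
    finally show "\<tau> \<gamma> * K = K * ?\<tau>" 
      by (rule cancel) (use K(1) \<tau>c[OF \<gamma>] c in auto)
  qed
qed

lemma real_normal_form:
  assumes G: "group \<Gamma>" and \<sigma>: "\<sigma> \<in> Rep \<Gamma> n" "conj_structure 1 \<Gamma> n \<sigma>"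
  obtains \<rho>' :: "'g \<Rightarrow> real mat" where "\<rho>' \<in> hom \<Gamma> (GL n)"
    "(\<lambda>\<gamma>. map_mat complex_of_real (\<rho>' \<gamma>)) \<in> Rep \<Gamma> n"
    "equivalent_reps \<Gamma> n \<sigma> n (\<lambda>\<gamma>. map_mat complex_of_real (\<rho>' \<gamma>))"
proof -
  obtain \<tau> where \<tau>: "\<tau> \<in> Rep \<Gamma> n" "equivalent_reps \<Gamma> n \<sigma> n \<tau>"
    and comm: "\<And>\<gamma>. \<gamma> \<in> carrier \<Gamma> \<Longrightarrow> \<tau> \<gamma> * 1\<^sub>m n = 1\<^sub>m n * map_mat cnj (\<tau> \<gamma>)"
    using conj_structure_normal_form[OF G \<sigma>, of "1\<^sub>m n"] by (auto simp: one_smult_mat)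
  define \<rho>' where "\<rho>' \<gamma> = map_mat Re (\<tau> \<gamma>)" for \<gamma>
  have \<rho>'c: "\<rho>' \<gamma> \<in> carrier_mat n n" if "\<gamma> \<in> carrier \<Gamma>" for \<gamma>
    using Rep_carrier[OF \<tau>(1) that] by (simp add: \<rho>'_def)
  have real: "map_mat complex_of_real (\<rho>' \<gamma>) = \<tau> \<gamma>" if \<gamma>: "\<gamma> \<in> carrier \<Gamma>" for \<gamma>
  proof (rule eq_matI)
    note c = Rep_carrier[OF \<tau>(1) \<gamma>]
    have "\<tau> \<gamma> = map_mat cnj (\<tau> \<gamma>)" using comm[OF \<gamma>] c by simp
    fix i j assume ij: "i < dim_row (\<tau> \<gamma>)" "j < dim_col (\<tau> \<gamma>)"
    have "\<tau> \<gamma> $$ (i, j) = map_mat cnj (\<tau> \<gamma>) $$ (i, j)" using \<open>\<tau> \<gamma> = map_mat cnj (\<tau> \<gamma>)\<close> by simp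
    then have "\<tau> \<gamma> $$ (i, j) \<in> \<real>" using ij by (simp add: Reals_cnj_iff)
    then show "map_mat complex_of_real (\<rho>' \<gamma>) $$ (i, j) = \<tau> \<gamma> $$ (i, j)"
      using ij by (simp add: \<rho>'_def)
  qed (simp_all add: \<rho>'_def)
  have "\<rho>' \<in> hom \<Gamma> (GL n)"
  proof (rule Rep_I[OF G \<rho>'c])
    interpret group \<Gamma> by fact
    fix \<gamma> \<delta> assume \<gamma>: "\<gamma> \<in> carrier \<Gamma>" and \<delta>: "\<delta> \<in> carrier \<Gamma>"
    have "map_mat complex_of_real (\<rho>' (\<gamma> \<otimes>\<^bsub>\<Gamma>\<^esub> \<delta>)) = map_mat complex_of_real (\<rho>' \<gamma> * \<rho>' \<delta>)"
      using real \<gamma> \<delta> Rep_mult[OF \<tau>(1) \<gamma> \<delta>] by (simp add: of_real_hom.mat_hom_mult[OF \<rho>'c[OF \<gamma>] \<rho>'c[OF \<delta>]])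
    then show "\<rho>' (\<gamma> \<otimes>\<^bsub>\<Gamma>\<^esub> \<delta>) = \<rho>' \<gamma> * \<rho>' \<delta>" by (rule of_real_hom.mat_hom_inj)
  next
    interpret group \<Gamma> by fact
    show "\<rho>' \<one>\<^bsub>\<Gamma>\<^esub> = 1\<^sub>m n"
      using Rep_one[OF G \<tau>(1)] by (auto simp: \<rho>'_def intro!: eq_matI)
  qed
  moreover have Rep: "(\<lambda>\<gamma>. map_mat complex_of_real (\<rho>' \<gamma>)) \<in> Rep \<Gamma> n"
    using \<tau>(1) real group.is_monoid[OF G] by (auto simp: hom_def Pi_iff monoid.m_closed)
  moreover have "equivalent_reps \<Gamma> n \<sigma> n (\<lambda>\<gamma>. map_mat complex_of_real (\<rho>' \<gamma>))"
    using \<tau>(2) real by (simp add: equivalent_reps_def intertwiner_def)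
  ultimately show ?thesis using that by blast
qed

lemma J_mat_carrier: "J_mat m \<in> carrier_mat (2 * m) (2 * m)"
  by (simp add: J_mat_def mult_2)

lemma J_mat_cnj: "map_mat cnj (J_mat m) = J_mat m"
  by (intro eq_matI) (auto simp: J_mat_def)

lemma J_mat_square: "J_mat m * J_mat m = (-1) \<cdot>\<^sub>m 1\<^sub>m (2 * m)"
proof -
  have "J_mat m * J_mat m = four_block_mat (- 1\<^sub>m m) (0\<^sub>m m m) (0\<^sub>m m m) (- 1\<^sub>m m)"
    unfolding J_mat_def by (subst mult_four_block_mat[of _ m m _ m _ m]) auto
  also have "\<dots> = (-1) \<cdot>\<^sub>m 1\<^sub>m (2 * m)" by (intro eq_matI) auto
  finally show ?thesis .
qed

lemma quaternionic_normal_form: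
  assumes G: "group \<Gamma>" and \<sigma>: "\<sigma> \<in> Rep \<Gamma> n" "conj_structure (-1) \<Gamma> n \<sigma>"
  obtains m \<rho>'' where "n = 2 * m" "\<rho>'' \<in> hom \<Gamma> (GL_H m)" "\<rho>'' \<in> Rep \<Gamma> n"
    "equivalent_reps \<Gamma> n \<sigma> n \<rho>''"
proof -
  obtain P where P: "P \<in> carrier_mat n n" "P * map_mat cnj P = (-1) \<cdot>\<^sub>m 1\<^sub>m n"
    using \<sigma>(2) by (auto simp: conj_structure_def intertwiner_def)
  \<comment> \<open>The dimension is even, as the determinant of the scalar matrix \<open>-1\<close> is a square modulus.\<close>
  have "det P * cnj (det P) = (-1) ^ n"
    using det_mult[of P n "map_mat cnj P"] P by (simp add: det_map_mat_cnj)
  then have "complex_of_real ((cmod (det P))\<^sup>2) = complex_of_real ((-1) ^ n)"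
    unfolding complex_norm_square by simp
  then have "(cmod (det P))\<^sup>2 = (-1) ^ n" by (simp only: of_real_eq_iff)
  then have "even n" using zero_le_power2[of "cmod (det P)"] by (cases "even n") simp_all
  then obtain m where m: "n = 2 * m" by (rule evenE)
  obtain \<tau> where \<tau>: "\<tau> \<in> Rep \<Gamma> n" "equivalent_reps \<Gamma> n \<sigma> n \<tau>"
    and comm: "\<And>\<gamma>. \<gamma> \<in> carrier \<Gamma> \<Longrightarrow> \<tau> \<gamma> * J_mat m = J_mat m * map_mat cnj (\<tau> \<gamma>)"
    using conj_structure_normal_form[OF G \<sigma>, of "J_mat m"] J_mat_carrier[of m] J_mat_cnj J_mat_square
    by (auto simp: m)
  have "\<tau> \<in> hom \<Gamma> (GL_H m)"
    using \<tau>(1) comm by (auto simp: hom_def GL_H_def m Pi_iff)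
  then show ?thesis using that m \<tau> by blast
qed

section \<open>Semisimple representations with real character\<close>

lemma irreducible_cnj_rep:
  assumes \<sigma>: "irreducible_rep \<Gamma> k \<sigma>"
  shows "irreducible_rep \<Gamma> k (cnj_rep \<sigma>)"
proof -
  have R: "\<sigma> \<in> Rep \<Gamma> k" using \<sigma> by (simp add: irreducible_rep_def)
  have vc: "map_vec cnj (map_vec cnj v) = v" for v by (intro eq_vecI) auto
  have mult: "map_vec cnj (A *\<^sub>v v) = map_mat cnj A *\<^sub>v map_vec cnj v"
    if "A \<in> carrier_mat k k" "v \<in> carrier_vec k" for A v
    using that by (intro eq_vecI) (auto simp: scalar_prod_def)
  have "W = {0\<^sub>v k} \<or> W = carrier_vec k" if W: "invariant_subspace \<Gamma> k (cnj_rep \<sigma>) W" for W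
  proof -
    let ?W = "map_vec cnj ` W"
    have sub: "W \<subseteq> carrier_vec k" using W by (simp add: invariant_subspace_def subspace_vec_iff)
    have W_iff: "v \<in> ?W \<longleftrightarrow> map_vec cnj v \<in> W" for v by (metis imageE image_eqI vc)
    have "invariant_subspace \<Gamma> k \<sigma> ?W"
      unfolding invariant_subspace_def subspace_vec_iff
    proof (intro conjI ballI allI subsetI)
      show "x \<in> carrier_vec k" if "x \<in> ?W" for x using that sub by auto
      have "map_vec cnj (0\<^sub>v k) = 0\<^sub>v k" by (intro eq_vecI) auto
      then show "0\<^sub>v k \<in> ?W" using W by (simp add: W_iff invariant_subspace_def subspace_vec_iff)
      show "x + y \<in> ?W" if xy: "x \<in> ?W" "y \<in> ?W" for x y
      proof -
        have "dim_vec x = k" "dim_vec y = k" using xy sub by auto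
        then have "map_vec cnj (x + y) = map_vec cnj x + map_vec cnj y" by (intro eq_vecI) auto
        then show ?thesis using W xy by (simp add: W_iff invariant_subspace_def subspace_vec_iff)
      qed
      show "c \<cdot>\<^sub>v x \<in> ?W" if "x \<in> ?W" for c x
      proof -
        have "map_vec cnj (c \<cdot>\<^sub>v x) = cnj c \<cdot>\<^sub>v map_vec cnj x" by (intro eq_vecI) auto
        then show ?thesis using W that by (simp add: W_iff invariant_subspace_def subspace_vec_iff)
      qed
      show "\<sigma> \<gamma> *\<^sub>v x \<in> ?W" if \<gamma>: "\<gamma> \<in> carrier \<Gamma>" and x: "x \<in> ?W" for \<gamma> x
      proof -
        have "x \<in> carrier_vec k" using x sub by auto
        then have "map_vec cnj (\<sigma> \<gamma> *\<^sub>v x) = cnj_rep \<sigma> \<gamma> *\<^sub>v map_vec cnj x"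
          using mult[OF Rep_carrier[OF R \<gamma>]] by (simp add: cnj_rep_def)
        then show ?thesis using W x \<gamma> by (simp add: W_iff invariant_subspace_def)
      qed
    qed
    then have "?W = {0\<^sub>v k} \<or> ?W = carrier_vec k"
      using \<sigma> by (simp add: irreducible_rep_def invariant_subspace_def)
    then show ?thesis
    proof
      assume W0: "?W = {0\<^sub>v k}"
      have "map_vec cnj (0\<^sub>v k) = 0\<^sub>v k" by (intro eq_vecI) auto
      moreover have "map_vec cnj ` ?W = W" by (simp add: image_image vc)
      ultimately show ?thesis using W0 by simp
    next
      assume "?W = carrier_vec k"
      then have "v \<in> W" if "v \<in> carrier_vec k" for v
        using that W_iff[of "map_vec cnj v"] by (simp add: vc)
      then show ?thesis using sub by blast
    qed
  qed
  then show ?thesis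
    using \<sigma> cnj_rep_in_Rep[OF R] by (auto simp: irreducible_rep_def invariant_subspace_def)
qed

lemma equivalent_cnj_rep:
  assumes \<sigma>: "\<sigma> \<in> Rep \<Gamma> k" and \<tau>: "\<tau> \<in> Rep \<Gamma> l" and equiv: "equivalent_reps \<Gamma> k \<sigma> l \<tau>"
  shows "equivalent_reps \<Gamma> k (cnj_rep \<sigma>) l (cnj_rep \<tau>)"
proof -
  obtain P Q where l: "l = k" and P: "P \<in> carrier_mat k k" and Q: "Q \<in> carrier_mat k k" "P * Q = 1\<^sub>m k"
    and comm: "\<And>\<gamma>. \<gamma> \<in> carrier \<Gamma> \<Longrightarrow> \<tau> \<gamma> * P = P * \<sigma> \<gamma>"
    using equivalent_repsE[OF equiv] by metis
  have "equivalent_reps \<Gamma> k (cnj_rep \<sigma>) k (cnj_rep \<tau>)"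
  proof (rule equivalent_repsI[of "map_mat cnj P" k "map_mat cnj Q"])
    show "map_mat cnj P * map_mat cnj Q = 1\<^sub>m k"
      using map_mat_cnj_mult[OF P Q(1)] Q(2) by simp
    fix \<gamma> assume \<gamma>: "\<gamma> \<in> carrier \<Gamma>"
    show "cnj_rep \<tau> \<gamma> * map_mat cnj P = map_mat cnj P * cnj_rep \<sigma> \<gamma>"
      using map_mat_cnj_mult[OF _ P, of "\<tau> \<gamma>"] map_mat_cnj_mult[OF P, of "\<sigma> \<gamma>"] comm[OF \<gamma>]
        Rep_carrier[OF \<sigma> \<gamma>] Rep_carrier[OF \<tau> \<gamma>] l by (simp add: cnj_rep_def)
  qed (use P Q in auto)
  then show ?thesis by (simp add: l)
qed

lemma mat_trace_equivalent_reps: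
  assumes "\<sigma> \<in> Rep \<Gamma> k" "\<tau> \<in> Rep \<Gamma> l" "equivalent_reps \<Gamma> k \<sigma> l \<tau>" "\<gamma> \<in> carrier \<Gamma>"
  shows "mat_trace (\<sigma> \<gamma>) = mat_trace (\<tau> \<gamma>)"
  using mat_trace_equivalent[OF assms(1-3), of "[(1, \<gamma>)]"] assms Rep_carrier[of \<sigma> \<Gamma> k \<gamma>] Rep_carrier[of \<tau> \<Gamma> l \<gamma>]
  by (simp add: one_smult_mat)

text \<open>
  The two parts are kept as representations with a structure instead of matrices in normal form:
  structures add up block by block, whereas a block sum of two matrices \<open>J\<close> is not again a
  matrix \<open>J\<close> but only conjugate to one by a permutation matrix.
\<close>

definition real_quaternionic_sum ::
  "('g, 'b) monoid_scheme \<Rightarrow> nat \<Rightarrow> ('g \<Rightarrow> complex mat) \<Rightarrow> bool" where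
  "real_quaternionic_sum \<Gamma> n \<sigma> \<longleftrightarrow> (\<exists>r s \<alpha> \<beta>.
     \<alpha> \<in> Rep \<Gamma> r \<and> conj_structure 1 \<Gamma> r \<alpha> \<and> \<beta> \<in> Rep \<Gamma> s \<and> conj_structure (-1) \<Gamma> s \<beta> \<and>
     equivalent_reps \<Gamma> n \<sigma> (r + s) (rep_sum \<alpha> \<beta>))"

lemma real_quaternionic_sum_equivalent:
  assumes "group \<Gamma>" "\<sigma> \<in> Rep \<Gamma> k" "\<tau> \<in> Rep \<Gamma> l" "equivalent_reps \<Gamma> k \<sigma> l \<tau>"
    and "real_quaternionic_sum \<Gamma> l \<tau>"
  shows "real_quaternionic_sum \<Gamma> k \<sigma>"
  using assms equivalent_reps_trans[OF assms(2,3) rep_sum_Rep[OF assms(1)] assms(4)]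
  unfolding real_quaternionic_sum_def by blast

lemma real_quaternionic_sum_add:
  assumes G: "group \<Gamma>" and \<sigma>: "\<sigma> \<in> Rep \<Gamma> k" "conj_structure 1 \<Gamma> k \<sigma> \<or> conj_structure (-1) \<Gamma> k \<sigma>"
    and \<tau>: "\<tau> \<in> Rep \<Gamma> l" "real_quaternionic_sum \<Gamma> l \<tau>"
  shows "real_quaternionic_sum \<Gamma> (k + l) (rep_sum \<sigma> \<tau>)"
proof -
  obtain r s \<alpha> \<beta> where \<alpha>: "\<alpha> \<in> Rep \<Gamma> r" "conj_structure 1 \<Gamma> r \<alpha>"
    and \<beta>: "\<beta> \<in> Rep \<Gamma> s" "conj_structure (-1) \<Gamma> s \<beta>"
    and equiv: "equivalent_reps \<Gamma> l \<tau> (r + s) (rep_sum \<alpha> \<beta>)"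
    using \<tau>(2) unfolding real_quaternionic_sum_def by blast
  note R = rep_sum_Rep[OF G] and refl = equivalent_reps_refl
  have step: "equivalent_reps \<Gamma> (k + l) (rep_sum \<sigma> \<tau>) (k + r + s) (rep_sum (rep_sum \<sigma> \<alpha>) \<beta>)"
    using rep_sum_equivalent[OF \<sigma>(1) \<sigma>(1) refl[OF \<sigma>(1)] \<tau>(1) R[OF \<alpha>(1) \<beta>(1)] equiv]
    by (simp add: rep_sum_assoc add.assoc)
  show ?thesis
    using \<sigma>(2)
  proof
    assume "conj_structure 1 \<Gamma> k \<sigma>"
    then have "conj_structure 1 \<Gamma> (k + r) (rep_sum \<sigma> \<alpha>)" using conj_structure_rep_sum \<sigma>(1) \<alpha> by blast
    then show ?thesis using step R[OF \<sigma>(1) \<alpha>(1)] \<beta> unfolding real_quaternionic_sum_def by blast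
  next
    assume "conj_structure (-1) \<Gamma> k \<sigma>"
    then have sum_structure: "conj_structure (-1) \<Gamma> (k + s) (rep_sum \<sigma> \<beta>)"
      using conj_structure_rep_sum \<sigma>(1) \<beta> by blast
    have "equivalent_reps \<Gamma> (k + r + s) (rep_sum (rep_sum \<sigma> \<alpha>) \<beta>) (r + k + s) (rep_sum (rep_sum \<alpha> \<sigma>) \<beta>)"
      by (intro rep_sum_equivalent R rep_sum_comm refl \<sigma>(1) \<alpha>(1) \<beta>(1))
    then have "equivalent_reps \<Gamma> (k + l) (rep_sum \<sigma> \<tau>) (r + k + s) (rep_sum (rep_sum \<alpha> \<sigma>) \<beta>)"
      by (rule equivalent_reps_trans[OF R[OF \<sigma>(1) \<tau>(1)] R[OF R[OF \<sigma>(1) \<alpha>(1)] \<beta>(1)]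
            R[OF R[OF \<alpha>(1) \<sigma>(1)] \<beta>(1)] step])
    then have "equivalent_reps \<Gamma> (k + l) (rep_sum \<sigma> \<tau>) (r + (k + s)) (rep_sum \<alpha> (rep_sum \<sigma> \<beta>))"
      by (simp add: rep_sum_assoc add.assoc)
    then show ?thesis using sum_structure R[OF \<sigma>(1) \<beta>(1)] \<alpha> unfolding real_quaternionic_sum_def by blast
  qed
qed

lemma real_quaternionic_sum_zero:
  fixes \<Gamma> :: "('g, 'b) monoid_scheme"
  assumes G: "group \<Gamma>"
  shows "real_quaternionic_sum \<Gamma> 0 (\<lambda>_. 0\<^sub>m 0 0)"
proof -
  let ?z = "\<lambda>_ :: 'g. 0\<^sub>m 0 0 :: complex mat"
  have Z: "?z \<in> Rep \<Gamma> 0" by (rule zero_dim_Rep[OF G])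
  have "rep_sum ?z ?z = ?z" by (auto simp: rep_sum_def block_sum_def intro!: eq_matI)
  moreover have "conj_structure \<epsilon> \<Gamma> 0 ?z" for \<epsilon>
    unfolding conj_structure_def intertwiner_def
    by (intro exI[of _ "0\<^sub>m 0 0"]) (auto simp: cnj_rep_def intro!: eq_matI)
  ultimately show ?thesis
    unfolding real_quaternionic_sum_def using Z equivalent_reps_refl[OF Z]
    by (intro exI[of _ 0] exI[of _ ?z]) simp
qed

lemma character_sum_Cons: "character_sum ((k, \<sigma>) # L) \<gamma> = mat_trace (\<sigma> \<gamma>) + character_sum L \<gamma>"
  by (simp add: character_sum_def)

lemma character_sum_move: "character_sum (A @ x # B) \<gamma> = character_sum (x # A @ B) \<gamma>"
  by (simp add: character_sum_def case_prod_unfold add.left_commute)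

text \<open>
  By induction on the number of summands.  The first summand \<open>\<sigma>\<close> is equivalent to the conjugate of
  some summand, because the character of the sum is real.  If that summand is \<open>\<sigma>\<close> itself, then
  \<open>\<sigma>\<close> is of real or quaternionic type; otherwise it pairs up with \<open>\<sigma>\<close> to a representation of
  real type.  In both cases the remaining summands again have a real character.
\<close>

lemma real_character_real_quaternionic_sum:
  assumes G: "group \<Gamma>"
    and irr: "\<And>k \<sigma>. (k, \<sigma>) \<in> set L \<Longrightarrow> irreducible_rep \<Gamma> k \<sigma>"
    and real: "\<And>\<gamma>. \<gamma> \<in> carrier \<Gamma> \<Longrightarrow> cnj (character_sum L \<gamma>) = character_sum L \<gamma>"
  shows "real_quaternionic_sum \<Gamma> (list_dim L) (list_rep L)"
  using irr real
proof (induction "length L" arbitrary: L rule: less_induct)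
  case less
  show ?case
  proof (cases L)
    case Nil
    then show ?thesis using real_quaternionic_sum_zero[OF G] by (simp add: list_rep_def)
  next
    case (Cons x L')
    obtain k \<sigma> where "x = (k, \<sigma>)" by (cases x)
    then have L: "L = (k, \<sigma>) # L'" using Cons by simp
    have Rep: "\<tau> \<in> Rep \<Gamma> l" if "(l, \<tau>) \<in> set L" for l \<tau>
      using less.prems(1)[OF that] by (simp add: irreducible_rep_def)
    have irr: "irreducible_rep \<Gamma> k \<sigma>" and R: "\<sigma> \<in> Rep \<Gamma> k" using less.prems(1)[of k \<sigma>] Rep[of k \<sigma>] L by auto
    have trace_cnj: "mat_trace (cnj_rep \<tau> \<gamma>) = cnj (mat_trace (\<tau> \<gamma>))"
      if "\<tau> \<in> Rep \<Gamma> l" "\<gamma> \<in> carrier \<Gamma>" for l \<tau> \<gamma>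
      using mat_trace_cnj[OF Rep_carrier[OF that]] by (simp add: cnj_rep_def)
    define L_cnj where "L_cnj = map (\<lambda>(l, \<tau>). (l, cnj_rep \<tau>)) L"
    have "character_sum L_cnj \<gamma> = cnj (character_sum L \<gamma>)" if \<gamma>: "\<gamma> \<in> carrier \<Gamma>" for \<gamma>
    proof -
      have "character_sum (map (\<lambda>(l, \<tau>). (l, cnj_rep \<tau>)) M) \<gamma> = cnj (character_sum M \<gamma>)"
        if "set M \<subseteq> set L" for M
        using that
      proof (induction M)
        case (Cons y M)
        obtain l \<tau> where y: "y = (l, \<tau>)" by (cases y)
        then show ?case using Cons trace_cnj[OF Rep[of l \<tau>] \<gamma>] by (simp add: character_sum_Cons)
      qed (simp add: character_sum_def)
      then show ?thesis by (simp add: L_cnj_def)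
    qed
    then have same: "character_sum L \<gamma> = character_sum L_cnj \<gamma>" if "\<gamma> \<in> carrier \<Gamma>" for \<gamma>
      using less.prems(2)[OF that] that by simp
    have irr_cnj: "irreducible_rep \<Gamma> l \<tau>" if "(l, \<tau>) \<in> set L_cnj" for l \<tau>
    proof -
      from that obtain \<mu> where "\<tau> = cnj_rep \<mu>" "(l, \<mu>) \<in> set L" by (auto simp: L_cnj_def)
      then show ?thesis using irreducible_cnj_rep[OF less.prems(1)] by blast
    qed
    have "(k, \<sigma>) \<in> set L" by (simp add: L)
    then obtain l \<tau>' where "(l, \<tau>') \<in> set L_cnj" "equivalent_reps \<Gamma> l \<tau>' k \<sigma>"
      using equal_characters_common_summand[OF G less.prems(1) irr_cnj same] by blast
    then obtain \<tau> where \<tau>: "(l, \<tau>) \<in> set L" and equiv: "equivalent_reps \<Gamma> l (cnj_rep \<tau>) k \<sigma>"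
      by (auto simp: L_cnj_def)
    have R\<tau>: "\<tau> \<in> Rep \<Gamma> l" using Rep[OF \<tau>] .
    have "equivalent_reps \<Gamma> l (cnj_rep (cnj_rep \<tau>)) k (cnj_rep \<sigma>)"
      by (rule equivalent_cnj_rep[OF cnj_rep_in_Rep[OF R\<tau>] R equiv])
    then have equiv': "equivalent_reps \<Gamma> l \<tau> k (cnj_rep \<sigma>)" by simp
    have trace_\<tau>: "mat_trace (\<tau> \<gamma>) = cnj (mat_trace (\<sigma> \<gamma>))" if "\<gamma> \<in> carrier \<Gamma>" for \<gamma>
      using mat_trace_equivalent_reps[OF R\<tau> cnj_rep_in_Rep[OF R] equiv' that] trace_cnj[OF R that] by simp
    show ?thesis
    proof (cases "(l, \<tau>) = (k, \<sigma>)")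
      case True
      have "cnj (character_sum L' \<gamma>) = character_sum L' \<gamma>" if \<gamma>: "\<gamma> \<in> carrier \<Gamma>" for \<gamma>
        using less.prems(2)[OF \<gamma>] trace_\<tau>[OF \<gamma>] True by (simp add: L character_sum_Cons)
      then have "real_quaternionic_sum \<Gamma> (list_dim L') (list_rep L')"
        using less.prems(1) by (intro less.hyps) (auto simp: L)
      moreover have "list_rep L' \<in> Rep \<Gamma> (list_dim L')" using Rep by (intro list_rep_Rep[OF G]) (auto simp: L)
      ultimately show ?thesis
        using real_quaternionic_sum_add[OF G R] irreducible_conj_structure[OF irr] equiv True
        by (simp add: L list_rep_Cons)
    next
      case False
      then have "(l, \<tau>) \<in> set L'" using \<tau> by (auto simp: L)
      then obtain A B where L': "L' = A @ (l, \<tau>) # B" by (auto simp: in_set_conv_decomp)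
      let ?M = "list_rep (A @ B)" and ?m = "list_dim (A @ B)"
      have M: "?M \<in> Rep \<Gamma> ?m" using Rep by (intro list_rep_Rep[OF G]) (auto simp: L L')
      have real': "cnj (character_sum (A @ B) \<gamma>) = character_sum (A @ B) \<gamma>" if \<gamma>: "\<gamma> \<in> carrier \<Gamma>" for \<gamma>
        using less.prems(2)[OF \<gamma>] trace_\<tau>[OF \<gamma>]
        by (simp add: L L' character_sum_Cons character_sum_move)
      have "real_quaternionic_sum \<Gamma> ?m ?M"
        using less.prems(1) real' by (intro less.hyps) (auto simp: L L')
      then have target: "real_quaternionic_sum \<Gamma> (k + k + ?m) (rep_sum (rep_sum \<sigma> (cnj_rep \<sigma>)) ?M)"
        using conj_structure_sum_cnj[OF R] rep_sum_Rep[OF G R cnj_rep_in_Rep[OF R]] M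
        by (intro real_quaternionic_sum_add[OF G]) auto
      have 1: "equivalent_reps \<Gamma> (list_dim L') (list_rep L') (l + ?m) (rep_sum \<tau> ?M)"
        using list_rep_move_to_front[OF G, of A "(l, \<tau>)" B] Rep by (simp add: L L' list_rep_Cons)
      have 2: "equivalent_reps \<Gamma> (l + ?m) (rep_sum \<tau> ?M) (k + ?m) (rep_sum (cnj_rep \<sigma>) ?M)"
        by (intro rep_sum_equivalent R\<tau> cnj_rep_in_Rep R equiv' M equivalent_reps_refl)
      have RL': "list_rep L' \<in> Rep \<Gamma> (list_dim L')" using Rep by (intro list_rep_Rep[OF G]) (auto simp: L)
      have "equivalent_reps \<Gamma> (list_dim L') (list_rep L') (k + ?m) (rep_sum (cnj_rep \<sigma>) ?M)"
        by (rule equivalent_reps_trans[OF RL' rep_sum_Rep[OF G R\<tau> M]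
              rep_sum_Rep[OF G cnj_rep_in_Rep[OF R] M] 1 2])
      then have "equivalent_reps \<Gamma> (k + list_dim L') (rep_sum \<sigma> (list_rep L'))
          (k + (k + ?m)) (rep_sum \<sigma> (rep_sum (cnj_rep \<sigma>) ?M))"
        by (intro rep_sum_equivalent R RL' equivalent_reps_refl rep_sum_Rep[OF G] cnj_rep_in_Rep M)
      then have "equivalent_reps \<Gamma> (list_dim L) (list_rep L)
          (k + k + ?m) (rep_sum (rep_sum \<sigma> (cnj_rep \<sigma>)) ?M)"
        by (simp add: L list_rep_Cons rep_sum_assoc add.assoc)
      moreover have "list_rep L \<in> Rep \<Gamma> (list_dim L)" by (rule list_rep_Rep[OF G Rep])
      ultimately show ?thesis
        using real_quaternionic_sum_equivalent[OF G _
            rep_sum_Rep[OF G rep_sum_Rep[OF G R cnj_rep_in_Rep[OF R]] M] _ target] by simp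
    qed
  qed
qed

section \<open>Points of the character variety\<close>

lemma conjugated_imp_equivalent_reps:
  assumes \<sigma>: "\<sigma> \<in> Rep \<Gamma> n" and conj: "conjugated \<Gamma> n \<sigma> \<tau>"
  shows "equivalent_reps \<Gamma> n \<sigma> n \<tau>"
proof -
  obtain P where P: "P \<in> carrier (GL n)" and \<tau>: "\<forall>\<gamma>\<in>carrier \<Gamma>. \<tau> \<gamma> = P * \<sigma> \<gamma> * inv\<^bsub>GL n\<^esub> P"
    using conj by (auto simp: conjugated_def conj_by_def)
  note Pc = GL_carrier_mat[OF P] and inv = GL_inv[OF P]
  show ?thesis
  proof (rule equivalent_repsI[OF Pc inv(1,2)])
    fix \<gamma> assume \<gamma>: "\<gamma> \<in> carrier \<Gamma>"
    show "\<tau> \<gamma> * P = P * \<sigma> \<gamma>"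
      using \<tau> \<gamma> Rep_carrier[OF \<sigma> \<gamma>] Pc inv by (simp add: assoc_mult_mat[of _ n n _ n _ n])
  qed
qed

lemma equivalent_reps_imp_conjugated:
  assumes \<sigma>: "\<sigma> \<in> Rep \<Gamma> n" and \<tau>: "\<tau> \<in> Rep \<Gamma> n" and equiv: "equivalent_reps \<Gamma> n \<sigma> n \<tau>"
  shows "conjugated \<Gamma> n \<sigma> \<tau>"
proof -
  obtain P where P: "P \<in> carrier (GL n)" and comm: "\<And>\<gamma>. \<gamma> \<in> carrier \<Gamma> \<Longrightarrow> \<tau> \<gamma> * P = P * \<sigma> \<gamma>"
    using equiv by (auto simp: equivalent_reps_def intertwiner_def)
  note Pc = GL_carrier_mat[OF P] and inv = GL_inv[OF P]
  have "\<tau> \<gamma> = P * \<sigma> \<gamma> * inv\<^bsub>GL n\<^esub> P" if \<gamma>: "\<gamma> \<in> carrier \<Gamma>" for \<gamma>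
    using comm[OF \<gamma>] assoc_mult_mat[OF Rep_carrier[OF \<tau> \<gamma>] Pc inv(1)] inv Rep_carrier[OF \<tau> \<gamma>] by simp
  then show ?thesis using P by (auto simp: conjugated_def conj_by_def)
qed

text \<open>
  Since it is an invariant function, the trace at \<open>\<gamma>\<close> depends only on the point of the character
  variety.
\<close>

lemma trace_invariant_function:
  assumes G: "group \<Gamma>" and \<gamma>: "\<gamma> \<in> carrier \<Gamma>"
  shows "(\<lambda>\<rho>\<in>Rep \<Gamma> n. mat_trace (\<rho> \<gamma>)) \<in> invariant_functions \<Gamma> n"
proof -
  have partial: "(\<lambda>\<rho>\<in>Rep \<Gamma> n. \<Sum>i<m. \<rho> \<gamma> $$ (i, i)) \<in> regular_functions \<Gamma> n" if "m \<le> n" for m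
    using that
  proof (induction m)
    case 0
    then show ?case using regular_functions.const[where c = 0 and \<Gamma> = \<Gamma> and n = n]
      by (simp only: lessThan_0 sum.empty)
  next
    case (Suc m)
    have "(\<lambda>\<rho>\<in>Rep \<Gamma> n. (\<lambda>\<rho>\<in>Rep \<Gamma> n. \<Sum>i<m. \<rho> \<gamma> $$ (i, i)) \<rho> + (\<lambda>\<rho>\<in>Rep \<Gamma> n. \<rho> \<gamma> $$ (m, m)) \<rho>)
        \<in> regular_functions \<Gamma> n"
      using Suc \<gamma> by (intro regular_functions.add regular_functions.coord) auto
    also have "?this \<longleftrightarrow> ?case" by (intro arg_cong[of _ _ "\<lambda>f. f \<in> _"] restrict_ext) simp
    finally show ?case .
  qed
  have "(\<lambda>\<rho>\<in>Rep \<Gamma> n. mat_trace (\<rho> \<gamma>)) = (\<lambda>\<rho>\<in>Rep \<Gamma> n. \<Sum>i<n. \<rho> \<gamma> $$ (i, i))"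
    using Rep_carrier[OF _ \<gamma>] by (intro restrict_ext) (fastforce simp: mat_trace_def)
  then have "(\<lambda>\<rho>\<in>Rep \<Gamma> n. mat_trace (\<rho> \<gamma>)) \<in> regular_functions \<Gamma> n" using partial[of n] by simp
  moreover have "mat_trace (conj_by n P \<rho> \<gamma>) = mat_trace (\<rho> \<gamma>)"
    if P: "P \<in> carrier (GL n)" and \<rho>: "\<rho> \<in> Rep \<Gamma> n" for P \<rho>
    unfolding conj_by_def
    using mat_trace_conjugate[OF Rep_carrier[OF \<rho> \<gamma>] GL_carrier_mat[OF P]] GL_inv[OF P] by blast
  ultimately show ?thesis using conj_by_in_Rep[OF G] by (auto simp: invariant_functions_def)
qed

theorem proposition6p6:
  fixes \<Gamma> :: "('g, 'b) monoid_scheme" and n :: nat and \<rho> :: "'g \<Rightarrow> complex mat"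
  assumes "finitely_generated_group \<Gamma>"
    and "0 < n"
    and "\<rho> \<in> Rep \<Gamma> n"
    and "semisimple_rep \<Gamma> n \<rho>"
    and "Phi1 \<Gamma> n (chi \<Gamma> n \<rho>) = chi \<Gamma> n \<rho>"
  shows "\<exists>r1 r2 \<rho>' \<rho>''. r1 + 2 * r2 = n \<and>
           \<rho>' \<in> hom \<Gamma> (GL r1 :: real mat monoid) \<and>
           \<rho>'' \<in> hom \<Gamma> (GL_H r2) \<and>
           conjugated \<Gamma> n \<rho> (\<lambda>\<gamma>. diag_block_mat [map_mat complex_of_real (\<rho>' \<gamma>), \<rho>'' \<gamma>])"
proof -
  have G: "group \<Gamma>" using assms(1) by (simp add: finitely_generated_group_def)
  note \<rho> = assms(3)
  have "chi \<Gamma> n (cnj_rep \<rho>) = chi \<Gamma> n \<rho>" using assms(5) Phi1_chi[OF G \<rho>] by simp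
  then have real: "cnj (mat_trace (\<rho> \<gamma>)) = mat_trace (\<rho> \<gamma>)" if \<gamma>: "\<gamma> \<in> carrier \<Gamma>" for \<gamma>
    using trace_invariant_function[OF G \<gamma>, of n] \<rho> cnj_rep_in_Rep[OF \<rho>]
      mat_trace_cnj[OF Rep_carrier[OF \<rho> \<gamma>]]
    by (auto simp: chi_eq_iff cnj_rep_def dest: bspec)
  obtain L where irr: "\<forall>(k, \<sigma>)\<in>set L. irreducible_rep \<Gamma> k \<sigma>" and n: "list_dim L = n"
    and conj: "conjugated \<Gamma> n \<rho> (list_rep L)"
    using assms(4) unfolding semisimple_rep_def list_rep_def by blast
  have Rep: "\<sigma> \<in> Rep \<Gamma> k" if "(k, \<sigma>) \<in> set L" for k \<sigma>
    using irr that by (auto simp: irreducible_rep_def)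
  have RL: "list_rep L \<in> Rep \<Gamma> n" using list_rep_Rep[OF G, of L, OF Rep] n by simp
  have equiv: "equivalent_reps \<Gamma> n \<rho> n (list_rep L)" by (rule conjugated_imp_equivalent_reps[OF \<rho> conj])
  have "cnj (character_sum L \<gamma>) = character_sum L \<gamma>" if \<gamma>: "\<gamma> \<in> carrier \<Gamma>" for \<gamma>
    using real[OF \<gamma>] mat_trace_equivalent_reps[OF \<rho> RL equiv \<gamma>] mat_trace_list_rep[OF G, of L, OF Rep \<gamma>] by simp
  then have "real_quaternionic_sum \<Gamma> n (list_rep L)"
    using real_character_real_quaternionic_sum[OF G, of L] irr n by auto
  then have "real_quaternionic_sum \<Gamma> n \<rho>"
    by (rule real_quaternionic_sum_equivalent[OF G \<rho> RL equiv])
  then obtain r s \<alpha> \<beta> where \<alpha>: "\<alpha> \<in> Rep \<Gamma> r" "conj_structure 1 \<Gamma> r \<alpha>"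
    and \<beta>: "\<beta> \<in> Rep \<Gamma> s" "conj_structure (-1) \<Gamma> s \<beta>"
    and \<rho>\<alpha>\<beta>: "equivalent_reps \<Gamma> n \<rho> (r + s) (rep_sum \<alpha> \<beta>)"
    unfolding real_quaternionic_sum_def by blast
  obtain \<rho>' :: "'g \<Rightarrow> real mat" where \<rho>': "\<rho>' \<in> hom \<Gamma> (GL r)"
      "(\<lambda>\<gamma>. map_mat complex_of_real (\<rho>' \<gamma>)) \<in> Rep \<Gamma> r"
      "equivalent_reps \<Gamma> r \<alpha> r (\<lambda>\<gamma>. map_mat complex_of_real (\<rho>' \<gamma>))"
    using real_normal_form[OF G \<alpha>] by blast
  obtain m \<rho>'' where \<rho>'': "s = 2 * m" "\<rho>'' \<in> hom \<Gamma> (GL_H m)" "\<rho>'' \<in> Rep \<Gamma> s"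
      "equivalent_reps \<Gamma> s \<beta> s \<rho>''"
    using quaternionic_normal_form[OF G \<beta>] by blast
  let ?\<sigma> = "rep_sum (\<lambda>\<gamma>. map_mat complex_of_real (\<rho>' \<gamma>)) \<rho>''"
  have dim: "r + s = n" using \<rho>\<alpha>\<beta> by (simp add: equivalent_reps_def)
  have R\<sigma>: "?\<sigma> \<in> Rep \<Gamma> (r + s)" by (rule rep_sum_Rep[OF G \<rho>'(2) \<rho>''(3)])
  have "equivalent_reps \<Gamma> (r + s) (rep_sum \<alpha> \<beta>) (r + s) ?\<sigma>"
    by (rule rep_sum_equivalent[OF \<alpha>(1) \<rho>'(2,3) \<beta>(1) \<rho>''(3,4)])
  then have "equivalent_reps \<Gamma> n \<rho> (r + s) ?\<sigma>"
    by (rule equivalent_reps_trans[OF \<rho> rep_sum_Rep[OF G \<alpha>(1) \<beta>(1)] R\<sigma> \<rho>\<alpha>\<beta>])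
  then have "conjugated \<Gamma> n \<rho> ?\<sigma>"
    using equivalent_reps_imp_conjugated[OF \<rho>] R\<sigma> dim by simp
  then have "conjugated \<Gamma> n \<rho> (\<lambda>\<gamma>. diag_block_mat [map_mat complex_of_real (\<rho>' \<gamma>), \<rho>'' \<gamma>])"
    unfolding rep_sum_def diag_block_mat_pair .
  then show ?thesis using dim \<rho>'(1) \<rho>''(1,2) by blast
qed

end
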